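(* Let $(X,Y)$ be a bivariate normal random vector with mean vector $(\mu_X,\mu_Y)\in\mathbb{R}^2$, variances $(\sigma_X^2,\sigma_Y^2)$ with $\sigma_X,\sigma_Y>0$, and correlation coefficient $\rho\in(-1,1)$. Let $Z=XY$, let $n\geq1$ be an integer, let $Z_1,\ldots,Z_n$ be independent copies of $Z$, let $S_n=\sum_{i=1}^n Z_i$, and let $f_{S_n}$ denote the probability density function of $S_n$. 1. Suppose $|\mu_X|/\sigma_X\neq|\mu_Y|/\sigma_Y$. Then, for $x>0$, \begin{align*} f_{S_n}(x) &= D_1(x) \int_0^\infty (t(t+1))^{(n-2)/4} \exp\bigg(-\frac{2x t}{\sigma_X\sigma_Y(1-\rho^2)}\bigg) I_{\frac{n}2-1}\bigg(\bigg|\frac{\mu_X}{\sigma_X}-\frac{\mu_Y}{\sigma_Y}\bigg|\frac{\sqrt{nxt}}{(1-\rho)\sqrt{\sigma_X\sigma_Y}}\bigg)\\ &\quad\times I_{\frac{n}2-1}\bigg(\bigg|\frac{\mu_X}{\sigma_X}+\frac{\mu_Y}{\sigma_Y}\bigg|\frac{\sqrt{nx(1+t)}}{(1+\rho)\sqrt{\sigma_X\sigma_Y}}\bigg)\,\mathrm{d}t, \end{align*} where \begin{align*} D_1(x) &= \frac{1}{\sigma_X\sigma_Y(1-\rho^2)}\bigg(\frac{n}{4}\bigg)^{1-n/2}\bigg|\frac{\mu_X^2}{\sigma_X^2}-\frac{\mu_Y^2}{\sigma_Y^2}\bigg|^{1-n/2}\bigg(\frac{x}{\sigma_X\sigma_Y}\bigg)^{n/2}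 \\ &\quad\times \exp\bigg(-\frac{n}{2(1-\rho^2)}\bigg(\frac{\mu_X^2}{\sigma_X^2}+\frac{\mu_Y^2}{\sigma_Y^2}-\frac{2\rho\mu_X\mu_Y}{\sigma_X\sigma_Y}\bigg)- \frac{x}{\sigma_X\sigma_Y(1+\rho)}\bigg). \end{align*} 2. Suppose $\mu_X/\sigma_X=\mu_Y/\sigma_Y$. Then, for $x>0$, $$f_{S_n}(x) = D_2(x) \int_0^\infty (t^2(t+1))^{(n-2)/4} \exp\bigg(-\frac{2x t}{\sigma_X\sigma_Y(1-\rho^2)}\bigg) I_{\frac{n}2-1}\bigg(\frac{2|\mu_X|}{\sigma_X}\frac{\sqrt{nx(1+t)}}{(1+\rho)\sqrt{\sigma_X\sigma_Y}}\bigg)\,\mathrm{d}t,$$ where $$D_2(x) = \frac{n^{(2-n)/4}}{\sigma_X\sigma_Y(1-\rho)^{n/2}(1+\rho)\Gamma(n/2)}\bigg(\frac{|\mu_X|}{\sigma_X}\bigg)^{1-n/2}\bigg(\frac{x}{\sigma_X\sigma_Y}\bigg)^{(3n-2)/4}\exp\bigg(-\frac{n\mu_X^2}{\sigma_X^2(1+\rho)}- \frac{x}{\sigma_X\sigma_Y(1+\rho)}\bigg).$$ 3. Suppose $\mu_X/\sigma_X=-\mu_Y/\sigma_Y$. Then, for $x>0$, $$f_{S_n}(x) = D_3(x) \int_0^\infty ((t+1)^2t)^{(n-2)/4} \exp\bigg(-\frac{2x t}{\sigma_X\sigma_Y(1-\rho^2)}\bigg) I_{\frac{n}2-1}\bigg(\frac{2|\mu_X|}{\sigma_X}\frac{\sqrt{nxt}}{(1-\rho)\sqrt{\sigma_X\sigma_Y}}\bigg)\,\mathrm{d}t,$$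 where $$D_3(x) = \frac{n^{(2-n)/4}}{\sigma_X\sigma_Y(1+\rho)^{n/2}(1-\rho)\Gamma(n/2)}\bigg(\frac{|\mu_X|}{\sigma_X}\bigg)^{1-n/2}\bigg(\frac{x}{\sigma_X\sigma_Y}\bigg)^{(3n-2)/4}\exp\bigg(-\frac{n\mu_X^2}{\sigma_X^2(1-\rho)}- \frac{x}{\sigma_X\sigma_Y(1+\rho)}\bigg).$$ 4. Formulas for the density $f_{S_n}(x)$ for $x<0$ follow from replacing $(x,\rho,\mu_Y)$ by $(-x,-\rho,-\mu_Y)$ in the formulas for $f_{S_n}(x)$ in parts 1, 2 and 3.
   Context: $I_\nu$ is the modified Bessel function of the first kind, $I_\nu(z)=\sum_{k=0}^\infty \frac{(z/2)^{2k+\nu}}{k!\,\Gamma(k+\nu+1)}$, and $\Gamma$ is the gamma function.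
   Formalization: In parts 2 and 3 (and their versions for x<0) with μ_X=μ_Y=0, where |μ_X|^{1-n/2} I_{n/2-1}(0) is indeterminate for n≠2, the right-hand side is read as its limit as μ_X tends to 0. *)

theory Defs
  imports "HOL-Probability.Probability"
begin

text \<open>
  Joint density of a bivariate normal vector with means \<open>mX\<close>, \<open>mY\<close>, standard deviations \<open>sX\<close>, \<open>sY\<close>
  and correlation coefficient \<open>r\<close>.
\<close>

definition bivariate_normal_density ::
  "real \<Rightarrow> real \<Rightarrow> real \<Rightarrow> real \<Rightarrow> real \<Rightarrow> real \<times> real \<Rightarrow> real" where
  "bivariate_normal_density mX mY sX sY r = (\<lambda>(x, y).
     1 / (2 * pi * sX * sY * sqrt (1 - r\<^sup>2)) *
     exp (- (((x - mX) / sX)\<^sup>2 - 2 * r * ((x - mX) / sX) * ((y - mY) / sY) + ((y - mY) / sY)\<^sup>2)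
            / (2 * (1 - r\<^sup>2))))"

definition bivariate_normal ::
  "'a measure \<Rightarrow> ('a \<Rightarrow> real) \<Rightarrow> ('a \<Rightarrow> real) \<Rightarrow> real \<Rightarrow> real \<Rightarrow> real \<Rightarrow> real \<Rightarrow> real \<Rightarrow> bool" where
  "bivariate_normal M X Y mX mY sX sY r \<longleftrightarrow>
     distributed M (lborel \<Otimes>\<^sub>M lborel) (\<lambda>\<omega>. (X \<omega>, Y \<omega>))
       (\<lambda>p. ennreal (bivariate_normal_density mX mY sX sY r p))"

text \<open>
  Modified Bessel function of the first kind, for real \<open>z \<ge> 0\<close>. The conditional restores
  \<open>0 powr 0 = 1\<close> (HOL has \<open>0 powr 0 = 0\<close>), so that \<open>I\<^sub>0(0) = 1\<close>. If \<open>k + v + 1\<close> is a pole of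
  \<open>Gamma\<close>, the term is \<open>0\<close>, in accordance with \<open>1 / Gamma = 0\<close> there.
\<close>

definition bessel_I :: "real \<Rightarrow> real \<Rightarrow> real" where
  "bessel_I v z =
     (\<Sum>k. (if 2 * real k + v = 0 then 1 else (z / 2) powr (2 * real k + v))
           / (fact k * Gamma (real k + v + 1)))"

definition D1 :: "nat \<Rightarrow> real \<Rightarrow> real \<Rightarrow> real \<Rightarrow> real \<Rightarrow> real \<Rightarrow> real \<Rightarrow> real" where
  "D1 n mX mY sX sY r x =
     1 / (sX * sY * (1 - r\<^sup>2)) * (real n / 4) powr (1 - real n / 2) *
     \<bar>mX\<^sup>2 / sX\<^sup>2 - mY\<^sup>2 / sY\<^sup>2\<bar> powr (1 - real n / 2) * (x / (sX * sY)) powr (real n / 2) *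
     exp (- (real n / (2 * (1 - r\<^sup>2))) * (mX\<^sup>2 / sX\<^sup>2 + mY\<^sup>2 / sY\<^sup>2 - 2 * r * mX * mY / (sX * sY))
          - x / (sX * sY * (1 + r)))"

definition integrand1 :: "nat \<Rightarrow> real \<Rightarrow> real \<Rightarrow> real \<Rightarrow> real \<Rightarrow> real \<Rightarrow> real \<Rightarrow> real \<Rightarrow> real" where
  "integrand1 n mX mY sX sY r x t =
     (t * (t + 1)) powr ((real n - 2) / 4) * exp (- (2 * x * t) / (sX * sY * (1 - r\<^sup>2))) *
     bessel_I (real n / 2 - 1)
       (\<bar>mX / sX - mY / sY\<bar> * (sqrt (real n * x * t) / ((1 - r) * sqrt (sX * sY)))) *
     bessel_I (real n / 2 - 1)
       (\<bar>mX / sX + mY / sY\<bar> * (sqrt (real n * x * (1 + t)) / ((1 + r) * sqrt (sX * sY))))"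

definition formula1 :: "nat \<Rightarrow> real \<Rightarrow> real \<Rightarrow> real \<Rightarrow> real \<Rightarrow> real \<Rightarrow> real \<Rightarrow> real" where
  "formula1 n mX mY sX sY r x =
     D1 n mX mY sX sY r x * (LBINT t:{0<..}. integrand1 n mX mY sX sY r x t)"

definition D2 :: "nat \<Rightarrow> real \<Rightarrow> real \<Rightarrow> real \<Rightarrow> real \<Rightarrow> real \<Rightarrow> real" where
  "D2 n mX sX sY r x =
     real n powr ((2 - real n) / 4) /
       (sX * sY * (1 - r) powr (real n / 2) * (1 + r) * Gamma (real n / 2)) *
     (\<bar>mX\<bar> / sX) powr (1 - real n / 2) * (x / (sX * sY)) powr ((3 * real n - 2) / 4) *
     exp (- (real n * mX\<^sup>2) / (sX\<^sup>2 * (1 + r)) - x / (sX * sY * (1 + r)))"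

definition integrand2 :: "nat \<Rightarrow> real \<Rightarrow> real \<Rightarrow> real \<Rightarrow> real \<Rightarrow> real \<Rightarrow> real \<Rightarrow> real" where
  "integrand2 n mX sX sY r x t =
     (t\<^sup>2 * (t + 1)) powr ((real n - 2) / 4) * exp (- (2 * x * t) / (sX * sY * (1 - r\<^sup>2))) *
     bessel_I (real n / 2 - 1)
       (2 * \<bar>mX\<bar> / sX * (sqrt (real n * x * (1 + t)) / ((1 + r) * sqrt (sX * sY))))"

definition formula2 :: "nat \<Rightarrow> real \<Rightarrow> real \<Rightarrow> real \<Rightarrow> real \<Rightarrow> real \<Rightarrow> real" where
  "formula2 n mX sX sY r x =
     D2 n mX sX sY r x * (LBINT t:{0<..}. integrand2 n mX sX sY r x t)"

definition D3 :: "nat \<Rightarrow> real \<Rightarrow> real \<Rightarrow> real \<Rightarrow> real \<Rightarrow> real \<Rightarrow> real" where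
  "D3 n mX sX sY r x =
     real n powr ((2 - real n) / 4) /
       (sX * sY * (1 + r) powr (real n / 2) * (1 - r) * Gamma (real n / 2)) *
     (\<bar>mX\<bar> / sX) powr (1 - real n / 2) * (x / (sX * sY)) powr ((3 * real n - 2) / 4) *
     exp (- (real n * mX\<^sup>2) / (sX\<^sup>2 * (1 - r)) - x / (sX * sY * (1 + r)))"

definition integrand3 :: "nat \<Rightarrow> real \<Rightarrow> real \<Rightarrow> real \<Rightarrow> real \<Rightarrow> real \<Rightarrow> real \<Rightarrow> real" where
  "integrand3 n mX sX sY r x t =
     ((t + 1)\<^sup>2 * t) powr ((real n - 2) / 4) * exp (- (2 * x * t) / (sX * sY * (1 - r\<^sup>2))) *
     bessel_I (real n / 2 - 1)
       (2 * \<bar>mX\<bar> / sX * (sqrt (real n * x * t) / ((1 - r) * sqrt (sX * sY))))"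

definition formula3 :: "nat \<Rightarrow> real \<Rightarrow> real \<Rightarrow> real \<Rightarrow> real \<Rightarrow> real \<Rightarrow> real" where
  "formula3 n mX sX sY r x =
     D3 n mX sX sY r x * (LBINT t:{0<..}. integrand3 n mX sX sY r x t)"

text \<open>
  \<open>value2 n mX sX sY r x y\<close>: the second formula has the value \<open>y\<close>, the integral being convergent.
  For \<open>mX = 0\<close> the formula contains an indeterminate product (\<open>0\<close> to the power \<open>1 - n / 2\<close> times
  \<open>I\<close> of order \<open>n / 2 - 1\<close> at \<open>0\<close>); its value is then the limit as \<open>mX\<close> tends to \<open>0\<close>.
  Likewise for \<open>value3\<close>.
\<close>

definition value1 :: "nat \<Rightarrow> real \<Rightarrow> real \<Rightarrow> real \<Rightarrow> real \<Rightarrow> real \<Rightarrow> real \<Rightarrow> real \<Rightarrow> bool" where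
  "value1 n mX mY sX sY r x y \<longleftrightarrow>
     set_integrable lborel {0<..} (integrand1 n mX mY sX sY r x) \<and> y = formula1 n mX mY sX sY r x"

definition value2 :: "nat \<Rightarrow> real \<Rightarrow> real \<Rightarrow> real \<Rightarrow> real \<Rightarrow> real \<Rightarrow> real \<Rightarrow> bool" where
  "value2 n mX sX sY r x y \<longleftrightarrow>
     (if mX \<noteq> 0
      then set_integrable lborel {0<..} (integrand2 n mX sX sY r x) \<and> y = formula2 n mX sX sY r x
      else ((\<lambda>m. formula2 n m sX sY r x) \<longlongrightarrow> y) (at 0))"

definition value3 :: "nat \<Rightarrow> real \<Rightarrow> real \<Rightarrow> real \<Rightarrow> real \<Rightarrow> real \<Rightarrow> real \<Rightarrow> bool" where
  "value3 n mX sX sY r x y \<longleftrightarrow>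
     (if mX \<noteq> 0
      then set_integrable lborel {0<..} (integrand3 n mX sX sY r x) \<and> y = formula3 n mX sX sY r x
      else ((\<lambda>m. formula3 n m sX sY r x) \<longlongrightarrow> y) (at 0))"

end

theory Submission
  imports Defs
begin

text \<open>
  With \<open>U = X / \<sigma>\<^sub>X\<close> and \<open>V = Y / \<sigma>\<^sub>Y\<close> one has \<open>X * Y = \<sigma>\<^sub>X * \<sigma>\<^sub>Y * ((U + V)\<^sup>2 - (U - V)\<^sup>2) / 4\<close>, and \<open>U + V\<close>,
  \<open>U - V\<close> are independent normal variables. So the law of \<open>X * Y\<close> is that of a difference of two
  independent scaled noncentral chi-squared variables with one degree of freedom. This family is
  closed under convolution, so \<open>S\<^sub>n\<close> is a difference \<open>P - Q\<close> of two independent scaled noncentral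
  chi-squared variables with \<open>n\<close> degrees of freedom, and its density at \<open>x > 0\<close> is the integral of
  \<open>f\<^sub>P (x + q) * f\<^sub>Q q\<close> over \<open>q > 0\<close>; the formulas result from \<open>q = x * t\<close> and the expression of the
  noncentral chi-squared density by a Bessel function. Writing that density with the entire function
  \<open>\<Sum>k. y ^ k / (k! * \<Gamma> (a + k))\<close> instead covers the central and noncentral cases uniformly.
\<close>

section \<open>An entire function underlying the modified Bessel functions\<close>

text \<open>Closure under convolution needs a common rate, but the two squares enter with the rates
  \<open>1 / (c * (1 + r))\<close> and \<open>1 / (c * (1 - r))\<close>, \<open>c = sX * sY\<close>.
  The \<open>n\<close> differences are therefore regrouped, at the level of measures, into all
  positive parts against all negative parts before any densities are convolved. The analytic base is
  one degree of freedom: there the entire function is a hyperbolic cosine, which is exactly what the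
  two square roots \<open>w\<close> and \<open>- w\<close> of a squared normal variable produce.
  Everything else follows from Beta integrals and the binomial theorem, without characteristic
  functions. Two degenerate places shape the statements. For \<open>n = 1\<close> the convolution
  integral is infinite at 0, so the real-valued density agrees with it only off that point. For
  vanishing means the Bessel form is indeterminate, whereas the entire function is continuous at
  noncentrality 0; the limit of the formulas is then obtained by dominated convergence.\<close>

definition bessel_series :: "real \<Rightarrow> real \<Rightarrow> real" where
  "bessel_series a y = (\<Sum>k. y ^ k / (fact k * Gamma (a + real k)))"

text \<open>Consecutive terms have ratio \<open>K / (a + real k)\<close>, which is at most 1/2 from
  some index on. The ratio test thus gives even summability, and a summable sequence is
  bounded.\<close>

lemma bounded_power_over_Gamma:
  assumes "a > 0" "K \<ge> 0"
  shows "\<exists>C>0. \<forall>k. K ^ k / Gamma (a + real k) \<le> C"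
proof -
  obtain N where N: "real N \<ge> 2 * K" using real_arch_simple by blast
  have "summable (\<lambda>k. K ^ k / Gamma (a + real k))"
  proof (rule summable_ratio_test[where c="1/2" and N="Suc N"])
    fix k assume k: "Suc N \<le> k"
    have "a + real k \<notin> \<int>\<^sub>\<le>\<^sub>0" using assms by (auto simp: nonpos_Ints_def)
    then have "Gamma (a + real (Suc k)) = (a + real k) * Gamma (a + real k)"
      using Gamma_plus1[of "a + real k"] by (simp add: add_ac)
    moreover have "2 * K \<le> a + real k" using N k assms by linarith
    moreover have "Gamma (a + real k) > 0" "a + real k > 0" using assms by auto
    ultimately have "K ^ Suc k / Gamma (a + real (Suc k)) = K / (a + real k) * (K ^ k / Gamma (a + real k))"
      by simp
    also have "\<dots> \<le> 1/2 * (K ^ k / Gamma (a + real k))"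
      using \<open>2 * K \<le> a + real k\<close> \<open>a + real k > 0\<close> assms \<open>Gamma (a + real k) > 0\<close>
      by (intro mult_right_mono) (auto simp: field_simps)
    finally show "norm (K ^ Suc k / Gamma (a + real (Suc k))) \<le> 1/2 * norm (K ^ k / Gamma (a + real k))"
      using assms Gamma_real_pos[of "a + real k"] Gamma_real_pos[of "a + real (Suc k)"]
      by (simp del: Gamma_real_pos)
  qed simp
  then have "Bseq (\<lambda>k. K ^ k / Gamma (a + real k))"
    by (meson convergent_imp_Bseq convergent_def summable_LIMSEQ_zero)
  then obtain C where "C > 0" "\<And>k. norm (K ^ k / Gamma (a + real k)) \<le> C"
    by (auto elim: BseqE)
  then show ?thesis by (intro exI[of _ C]) (auto intro: order_trans[OF abs_ge_self])
qed

text \<open>Splitting off the bounded factor \<open>(1/e) ^ k / Gamma (a + real k)\<close> leaves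
  the exponential series in \<open>e * y\<close>. The true exponential order is only
  \<open>2 * sqrt y\<close>, so \<open>e\<close> may be arbitrarily small; this freedom lets the
  factor \<open>exp (- b * x)\<close> of the densities win for every noncentrality. Summability
  comes from the same comparison and is therefore part of the conclusion.\<close>

lemma bessel_series_bound:
  assumes "a > 0" "e > 0"
  shows "\<exists>C>0. \<forall>y\<ge>0. summable (\<lambda>k. y ^ k / (fact k * Gamma (a + real k))) \<and>
    bessel_series a y \<le> C * exp (e * y)"
proof -
  obtain C where C: "C > 0" "\<And>k. (1/e) ^ k / Gamma (a + real k) \<le> C"
    using bounded_power_over_Gamma[of a "1/e"] assms by auto
  have "summable (\<lambda>k. y ^ k / (fact k * Gamma (a + real k))) \<and>
    bessel_series a y \<le> C * exp (e * y)" if y: "y \<ge> 0" for y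
  proof -
    have le: "y ^ k / (fact k * Gamma (a + real k)) \<le> C * ((e * y) ^ k / fact k)" for k
    proof -
      have "y ^ k / (fact k * Gamma (a + real k)) =
          (1/e) ^ k / Gamma (a + real k) * ((e * y) ^ k / fact k)"
        using assms by (simp add: power_mult_distrib field_simps)
      also have "\<dots> \<le> C * ((e * y) ^ k / fact k)"
        using assms y C by (intro mult_right_mono) auto
      finally show ?thesis .
    qed
    have s: "(\<lambda>k. C * ((e * y) ^ k / fact k)) sums (C * exp (e * y))"
      using exp_converges[of "e * y"] by (intro sums_mult) (simp add: divide_inverse mult.commute)
    have nn: "0 \<le> y ^ k / (fact k * Gamma (a + real k))" for k
      using y assms by (auto intro!: divide_nonneg_nonneg mult_nonneg_nonneg less_imp_le Gamma_real_pos)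
    have sm: "summable (\<lambda>k. y ^ k / (fact k * Gamma (a + real k)))"
      by (rule summable_comparison_test'[OF sums_summable[OF s], of 0]) (use le nn in \<open>simp only: real_norm_def abs_of_nonneg\<close>)
    show ?thesis
      using sm suminf_le[OF le sm sums_summable[OF s]] sums_unique[OF s]
      by (simp add: bessel_series_def)
  qed
  with C show ?thesis by blast
qed

text \<open>The comparison with the exponential series covers nonnegative arguments only; negative
  ones are reached because a power series converging at \<open>\<bar>y\<bar> + 1\<close> converges
  at every point of smaller modulus.\<close>

lemma summable_bessel_series:
  assumes "a > 0"
  shows "summable (\<lambda>k. y ^ k / (fact k * Gamma (a + real k)))"
proof -
  have "summable (\<lambda>k. (1 / (fact k * Gamma (a + real k))) * y ^ k)"
  proof (rule powser_inside)
    show "summable (\<lambda>k. (1 / (fact k * Gamma (a + real k))) * (\<bar>y\<bar> + 1) ^ k)"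
      using bessel_series_bound[of a 1] assms by (auto dest!: spec[of _ "\<bar>y\<bar> + 1"])
  qed simp
  then show ?thesis by simp
qed

lemma bessel_series_nonneg:
  assumes "a > 0" "y \<ge> 0"
  shows "0 \<le> bessel_series a y"
  unfolding bessel_series_def using assms
  by (intro suminf_nonneg summable_bessel_series)
    (auto intro!: divide_nonneg_nonneg mult_nonneg_nonneg less_imp_le Gamma_real_pos)

lemma bessel_series_mono:
  assumes "a > 0" "0 \<le> y" "y \<le> z"
  shows "bessel_series a y \<le> bessel_series a z"
  unfolding bessel_series_def using assms
  by (intro suminf_le summable_bessel_series divide_right_mono power_mono)
    (auto intro!: mult_nonneg_nonneg less_imp_le Gamma_real_pos)

lemma bessel_series_0: "bessel_series a 0 = 1 / Gamma a"
proof -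
  have "(\<lambda>k. 0 ^ k / (fact k * Gamma (a + real k))) = (\<lambda>k. if k = 0 then 1 / Gamma a else 0)"
    by (auto simp: fun_eq_iff)
  then show ?thesis
    unfolding bessel_series_def
    by (metis (no_types, lifting) sums_single[of 0 "\<lambda>_. 1 / Gamma a"] sums_unique)
qed

lemma continuous_bessel_series:
  assumes "a > 0"
  shows "isCont (bessel_series a) y"
proof -
  have "isCont (\<lambda>x. \<Sum>k. (1 / (fact k * Gamma (a + real k))) * x ^ k) y"
    by (rule isCont_powser_converges_everywhere) (use summable_bessel_series[OF assms] in simp)
  then show ?thesis by (simp add: bessel_series_def[abs_def])
qed

lemma borel_measurable_bessel_series [measurable]:
  "a > 0 \<Longrightarrow> bessel_series a \<in> borel_measurable borel"
  using continuous_bessel_series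
  by (auto intro!: borel_measurable_continuous_onI continuous_at_imp_continuous_on)

text \<open>The condition \<open>v > -1\<close> keeps all Gamma arguments positive. For
  \<open>z > 0\<close> a power with exponent 0 is 1, so the conditional in \<open>bessel_I\<close>
  agrees with the plain power and \<open>(z / 2) powr v\<close> can be taken out of every
  term.\<close>

lemma bessel_I_eq_bessel_series:
  assumes "v > -1" "z > 0"
  shows "bessel_I v z = (z / 2) powr v * bessel_series (v + 1) ((z / 2)\<^sup>2)"
proof -
  have "(\<lambda>k. (if 2 * real k + v = 0 then 1 else (z / 2) powr (2 * real k + v))
           / (fact k * Gamma (real k + v + 1))) =
        (\<lambda>k. (z / 2) powr v * (((z / 2)\<^sup>2) ^ k / (fact k * Gamma (v + 1 + real k))))"
  proof
    fix k
    have "(if 2 * real k + v = 0 then 1 else (z / 2) powr (2 * real k + v)) = (z / 2) powr (real (2 * k) + v)"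
      using assms by simp
    also have "\<dots> = ((z / 2)\<^sup>2) ^ k * (z / 2) powr v"
      using assms by (simp only: powr_add powr_realpow power_mult[symmetric] half_gt_zero_iff)
    finally show "(if 2 * real k + v = 0 then 1 else (z / 2) powr (2 * real k + v))
           / (fact k * Gamma (real k + v + 1)) =
         (z / 2) powr v * (((z / 2)\<^sup>2) ^ k / (fact k * Gamma (v + 1 + real k)))"
      by (simp add: add_ac)
  qed
  then show ?thesis
    unfolding bessel_I_def bessel_series_def
    using suminf_mult[OF summable_bessel_series[of "v + 1"]] assms by simp
qed

text \<open>Legendre duplication at half-integers with the denominators cleared. It turns
  \<open>fact k * Gamma (1/2 + real k)\<close> into \<open>fact (2 * k)\<close>, up to
  \<open>sqrt pi\<close> and a power of 4: the denominators of the even part of the exponential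
  series.\<close>

lemma Gamma_half_plus_nat: "Gamma (1/2 + real k) * fact k * 4 ^ k = sqrt pi * fact (2 * k)"
proof (induction k)
  case (Suc k)
  have "1/2 + real k \<notin> \<int>\<^sub>\<le>\<^sub>0" by (auto simp: nonpos_Ints_def)
  then have "Gamma (1/2 + real (Suc k)) = (1/2 + real k) * Gamma (1/2 + real k)"
    using Gamma_plus1[of "1/2 + real k"] by (simp add: add_ac)
  then have "Gamma (1/2 + real (Suc k)) * fact (Suc k) * 4 ^ Suc k =
      (1/2 + real k) * (real k + 1) * 4 * (Gamma (1/2 + real k) * fact k * 4 ^ k)"
    by (simp only: fact_Suc power_Suc of_nat_Suc of_nat_mult of_nat_fact) (simp only: mult_ac add.commute)
  also have "\<dots> = sqrt pi * fact (2 * Suc k)"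
    unfolding Suc by (simp add: algebra_simps)
  finally show ?case .
qed (simp add: Gamma_one_half_real)

text \<open>This is the elementary form of the Bessel function of order -1/2. The parameter 1/2
  belongs to one degree of freedom.\<close>

lemma bessel_series_half: "bessel_series (1/2) (y\<^sup>2) = cosh (2 * y) / sqrt pi"
proof -
  have "(\<lambda>n. if even n then (2 * y) ^ n /\<^sub>R fact n else 0) sums cosh (2 * y)"
    by (rule cosh_converges)
  \<comment> \<open>The odd terms are zero, so the series can be reindexed along the even
    numbers.\<close>
  then have "(\<lambda>k. (2 * y) ^ (2 * k) /\<^sub>R fact (2 * k)) sums cosh (2 * y)"
    by (subst (asm) sums_mono_reindex[where g="\<lambda>k. 2 * k", symmetric])
      (auto simp: strict_mono_def elim!: evenE)
  then have "(\<lambda>k. (2 * y) ^ (2 * k) /\<^sub>R fact (2 * k) / sqrt pi) sums (cosh (2 * y) / sqrt pi)"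
    by (rule sums_divide)
  also have "(\<lambda>k. (2 * y) ^ (2 * k) /\<^sub>R fact (2 * k) / sqrt pi) =
      (\<lambda>k. (y\<^sup>2) ^ k / (fact k * Gamma (1/2 + real k)))"
  proof
    fix k
    have g: "fact k * Gamma (1/2 + real k) = sqrt pi * fact (2 * k) / 4 ^ k"
      using Gamma_half_plus_nat[of k] by (simp add: eq_divide_eq mult_ac)
    show "(2 * y) ^ (2 * k) /\<^sub>R fact (2 * k) / sqrt pi = (y\<^sup>2) ^ k / (fact k * Gamma (1/2 + real k))"
      unfolding g power_mult[of _ 2 k] by (simp add: power_mult_distrib field_simps)
  qed
  finally show ?thesis by (simp add: bessel_series_def sums_iff)
qed

section \<open>Noncentral Gamma densities and their convolution\<close>

text \<open>A scaled noncentral chi-squared law with \<open>2 * a\<close> degrees of freedom, scale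
  \<open>1 / (2 * b)\<close> and noncentrality \<open>2 * d\<close>. Here \<open>b\<close> is the
  rate of the mixed Gamma laws and \<open>d\<close> the mean of the mixing Poisson law.\<close>

definition nc_gamma_density :: "real \<Rightarrow> real \<Rightarrow> real \<Rightarrow> real \<Rightarrow> real" where
  "nc_gamma_density a b d x =
     (if x > 0 then b powr a * x powr (a - 1) * exp (- b * x - d) * bessel_series a (d * b * x) else 0)"

lemma nc_gamma_density_nonneg:
  assumes "a > 0" "b > 0" "d \<ge> 0"
  shows "0 \<le> nc_gamma_density a b d x"
  using assms by (auto simp: nc_gamma_density_def intro!: mult_nonneg_nonneg bessel_series_nonneg)

lemma borel_measurable_nc_gamma_density [measurable]:
  "a > 0 \<Longrightarrow> nc_gamma_density a b d \<in> borel_measurable borel"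
  unfolding nc_gamma_density_def[abs_def] by measurable

text \<open>Euler's Beta integral after the substitution \<open>y = x * t\<close>.\<close>

lemma nn_integral_powr_convolution:
  assumes p: "p > 0" and q: "q > 0" and x: "x > 0"
  shows "(\<integral>\<^sup>+y. ennreal (indicator {0<..<x} y * ((x - y) powr (p - 1) * y powr (q - 1))) \<partial>lborel) =
    ennreal (x powr (p + q - 1) * Beta p q)"
proof -
  have "(\<integral>\<^sup>+y. ennreal (indicator {0<..<x} y * ((x - y) powr (p - 1) * y powr (q - 1))) \<partial>lborel) =
     ennreal x * (\<integral>\<^sup>+t. ennreal (indicator {0<..<x} (x * t) * ((x - x * t) powr (p - 1) * (x * t) powr (q - 1))) \<partial>lborel)"
    using x by (subst nn_integral_real_affine[where c=x and t=0]) auto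
  also have "(\<lambda>t. ennreal (indicator {0<..<x} (x * t) * ((x - x * t) powr (p - 1) * (x * t) powr (q - 1)))) =
     (\<lambda>t. ennreal (x powr (p + q - 2)) * ennreal (indicator {0..1} t * (t powr (q - 1) * (1 - t) powr (p - 1))))"
  proof
    fix t :: real
    show "ennreal (indicator {0<..<x} (x * t) * ((x - x * t) powr (p - 1) * (x * t) powr (q - 1))) =
      ennreal (x powr (p + q - 2)) * ennreal (indicator {0..1} t * (t powr (q - 1) * (1 - t) powr (p - 1)))"
    proof (cases "0 < t \<and> t < 1")
      case True
      have "x - x * t = x * (1 - t)" by (simp add: algebra_simps)
      then have "(x - x * t) powr (p - 1) * (x * t) powr (q - 1) =
          x powr (p + q - 2) * (t powr (q - 1) * (1 - t) powr (p - 1))"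
        using True x by (simp add: powr_mult powr_add[symmetric])
      with True x show ?thesis by (simp add: ennreal_mult[symmetric])
    next
      case False
      then have "\<not> (0 < x * t \<and> x * t < x)" using x by (auto simp: zero_less_mult_iff)
      \<comment> \<open>The Beta integral runs over the closed interval; its endpoints contribute
        nothing because \<open>0 powr p = 0\<close> for every \<open>p\<close>.\<close>
      moreover have "indicator {0..1} t * (t powr (q - 1) * (1 - t) powr (p - 1)) = 0"
        using False by (cases "t = 0"; cases "t = 1") (auto simp: indicator_def)
      ultimately show ?thesis by (auto simp: indicator_def)
    qed
  qed
  also have "(\<integral>\<^sup>+t. ennreal (x powr (p + q - 2)) * ennreal (indicator {0..1} t * (t powr (q - 1) * (1 - t) powr (p - 1))) \<partial>lborel)
      = ennreal (x powr (p + q - 2)) * ennreal (Beta q p)"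
    by (subst nn_integral_cmult)
      (auto simp: nn_integral_has_integral_lebesgue[OF _ has_integral_Beta_real[OF q p]])
  also have "ennreal x * (ennreal (x powr (p + q - 2)) * ennreal (Beta q p)) = ennreal (x powr (p + q - 1) * Beta p q)"
  proof -
    have "x powr (p + q - 1) = x * x powr (p + q - 2)"
      using x by (simp add: powr_mult_base)
    then show ?thesis
      using x p q by (simp add: ennreal_mult[symmetric] Beta_commute[of q p] Beta_def Gamma_real_pos less_imp_le mult_ac add_ac)
  qed
  finally show ?thesis .
qed

lemma bessel_series_mult_sums:
  assumes "a > 0" "a' > 0" "s \<ge> 0" "t \<ge> 0"
  shows "(\<lambda>l. \<Sum>i\<le>l. s ^ i / (fact i * Gamma (a + real i)) * (t ^ (l - i) / (fact (l - i) * Gamma (a' + real (l - i)))))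
     sums (bessel_series a s * bessel_series a' t)"
proof -
  have "summable (\<lambda>k. norm (y ^ k / (fact k * Gamma (c + real k))))" if "c > 0" "y \<ge> 0" for c y :: real
  proof -
    have "(\<lambda>k. norm (y ^ k / (fact k * Gamma (c + real k)))) = (\<lambda>k. y ^ k / (fact k * Gamma (c + real k)))"
      using that by (auto simp: fun_eq_iff abs_mult less_imp_le Gamma_real_pos)
    then show ?thesis using summable_bessel_series[OF that(1), of y] by simp
  qed
  then show ?thesis
    unfolding bessel_series_def using assms by (intro Cauchy_product_sums) auto
qed

text \<open>
  The density is the Poisson mixture of the Gamma densities of shape \<open>a + k\<close>; convolution adds
  the shapes (Beta integral) and the Poisson parameters (binomial theorem).
\<close>

lemma nc_gamma_density_convolution:
  assumes a: "a > 0" "a' > 0" and b: "b > 0" and d: "d \<ge> 0" "d' \<ge> 0"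
  shows "(\<integral>\<^sup>+y. ennreal (nc_gamma_density a b d (x - y)) * ennreal (nc_gamma_density a' b d' y) \<partial>lborel) =
    ennreal (nc_gamma_density (a + a') b (d + d') x)"
proof (cases "x > 0")
  case False
  then have "ennreal (nc_gamma_density a b d (x - y)) * ennreal (nc_gamma_density a' b d' y) = 0" for y
    by (simp add: nc_gamma_density_def)
  then have "(\<integral>\<^sup>+y. ennreal (nc_gamma_density a b d (x - y)) * ennreal (nc_gamma_density a' b d' y) \<partial>lborel) = 0"
    by (simp only: nn_integral_const mult_zero_left)
  with False show ?thesis by (simp add: nc_gamma_density_def)
next
  case x: True
  define K where "K = b powr (a + a') * exp (- b * x - (d + d'))"
  define D D' where "D = d * b" and "D' = d' * b"
  \<comment> \<open>\<open>l\<close> is the total degree in a Cauchy product and \<open>i\<close>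
    the share of the first series; \<open>co\<close> collects what is independent of
    \<open>y\<close>, and \<open>w\<close> is what has to be integrated. Grouping by
    \<open>l\<close> makes the inner sum finite and lets the binomial theorem act for each
    \<open>l\<close> separately.\<close>
  define co where "co l i = D ^ i / (fact i * Gamma (a + real i)) * (D' ^ (l - i) / (fact (l - i) * Gamma (a' + real (l - i))))" for l i
  define w where "w l i y = indicator {0<..<x} y * ((x - y) powr (a + real i - 1) * y powr (a' + real (l - i) - 1))" for l i :: nat and y
  have K: "K \<ge> 0" and D: "D \<ge> 0" "D' \<ge> 0" using b d by (auto simp: K_def D_def D'_def)
  have co: "co l i \<ge> 0" for l i
    unfolding co_def using a D
    by (auto intro!: divide_nonneg_nonneg mult_nonneg_nonneg less_imp_le Gamma_real_pos)
  have w: "w l i y \<ge> 0" for l i y by (auto simp: w_def)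
  have [measurable]: "w l i \<in> borel_measurable borel" for l i
    unfolding w_def[abs_def] by measurable
  have pointwise: "ennreal (nc_gamma_density a b d (x - y)) * ennreal (nc_gamma_density a' b d' y) =
      ennreal K * (\<Sum>l. \<Sum>i\<le>l. ennreal (co l i) * ennreal (w l i y))" for y
  proof (cases "0 < y \<and> y < x")
    case True
    have eq: "(\<lambda>l. \<Sum>i\<le>l. co l i * w l i y) =
      (\<lambda>l. (x - y) powr (a - 1) * y powr (a' - 1) * (\<Sum>i\<le>l. (D * (x - y)) ^ i / (fact i * Gamma (a + real i)) * ((D' * y) ^ (l - i) / (fact (l - i) * Gamma (a' + real (l - i))))))"
    proof (intro ext, unfold sum_distrib_left, intro sum.cong refl)
      fix l i
      have "(x - y) powr (a + real i - 1) = (x - y) powr (a - 1) * (x - y) ^ i"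
        "y powr (a' + real (l - i) - 1) = y powr (a' - 1) * y ^ (l - i)"
        using True powr_add[of "x - y" "a - 1" "real i"] powr_add[of y "a' - 1" "real (l - i)"]
        by (simp_all add: powr_realpow algebra_simps)
      then show "co l i * w l i y = (x - y) powr (a - 1) * y powr (a' - 1) *
        ((D * (x - y)) ^ i / (fact i * Gamma (a + real i)) * ((D' * y) ^ (l - i) / (fact (l - i) * Gamma (a' + real (l - i)))))"
        using True by (simp add: co_def w_def power_mult_distrib)
    qed
    have sums: "(\<lambda>l. \<Sum>i\<le>l. co l i * w l i y) sums ((x - y) powr (a - 1) * y powr (a' - 1) *
        (bessel_series a (D * (x - y)) * bessel_series a' (D' * y)))"
      unfolding eq using True D a by (intro sums_mult bessel_series_mult_sums) auto
    have "exp (- b * (x - y) - d) * exp (- b * y - d') = exp (- b * x - (d + d'))"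
      by (simp add: exp_add[symmetric] algebra_simps)
    then have "nc_gamma_density a b d (x - y) * nc_gamma_density a' b d' y =
        K * ((x - y) powr (a - 1) * y powr (a' - 1) *
        (bessel_series a (D * (x - y)) * bessel_series a' (D' * y)))"
      using True unfolding nc_gamma_density_def K_def D_def D'_def powr_add
      by (simp add: mult_ac)
    also have "\<dots> = K * (\<Sum>l. \<Sum>i\<le>l. co l i * w l i y)"
      using sums by (simp add: sums_iff)
    finally have "ennreal (nc_gamma_density a b d (x - y)) * ennreal (nc_gamma_density a' b d' y) =
        ennreal (K * (\<Sum>l. \<Sum>i\<le>l. co l i * w l i y))"
      using a b d by (simp add: ennreal_mult[symmetric] nc_gamma_density_nonneg)
    also have "\<dots> = ennreal K * ennreal (\<Sum>l. \<Sum>i\<le>l. co l i * w l i y)"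
      using K sums co w by (intro ennreal_mult suminf_nonneg sum_nonneg mult_nonneg_nonneg) (auto simp: sums_iff)
    also have "ennreal (\<Sum>l. \<Sum>i\<le>l. co l i * w l i y) = (\<Sum>l. ennreal (\<Sum>i\<le>l. co l i * w l i y))"
      using sums co w by (intro suminf_ennreal2[symmetric] sum_nonneg mult_nonneg_nonneg) (auto simp: sums_iff)
    also have "\<dots> = (\<Sum>l. \<Sum>i\<le>l. ennreal (co l i) * ennreal (w l i y))"
      using co w by (simp add: ennreal_mult[symmetric])
    finally show ?thesis .
  next
    case False
    then show ?thesis by (auto simp: nc_gamma_density_def w_def)
  qed
  have int_w: "(\<integral>\<^sup>+y. ennreal (w l i y) \<partial>lborel) =
     ennreal (x powr (a + a' + real l - 1) * Beta (a + real i) (a' + real (l - i)))" if "i \<le> l" for l i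
  proof -
    have "a + real i + (a' + real (l - i)) = a + a' + real l" using that by (simp add: of_nat_diff)
    then show ?thesis
      using nn_integral_powr_convolution[of "a + real i" "a' + real (l - i)" x] a x
      by (simp add: w_def add.assoc)
  qed
  \<comment> \<open>The Gamma factors in the denominator of \<open>co\<close> cancel the numerator
    of the Beta integral, and \<open>fact i * fact (l - i)\<close> becomes a binomial coefficient
    over \<open>fact l\<close>; the sum over \<open>i\<close> is then
    \<open>(D + D') ^ l\<close>.\<close>
  have coeff: "(\<Sum>i\<le>l. ennreal (co l i) * ennreal (x powr (a + a' + real l - 1) * Beta (a + real i) (a' + real (l - i)))) =
     ennreal (x powr (a + a' - 1) * (((d + d') * b * x) ^ l / (fact l * Gamma (a + a' + real l))))" for l
  proof -
    have "co l i * (x powr (a + a' + real l - 1) * Beta (a + real i) (a' + real (l - i))) =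
       x powr (a + a' + real l - 1) / (fact l * Gamma (a + a' + real l)) * (of_nat (l choose i) * D ^ i * D' ^ (l - i))"
      if "i \<le> l" for i
    proof -
      have "a + real i + (a' + real (l - i)) = a + a' + real l" using that by (simp add: of_nat_diff)
      moreover have "Gamma (a + real i) > 0" "Gamma (a' + real (l - i)) > 0" using a by auto
      moreover have "real (l choose i) = fact l / (fact i * fact (l - i))"
        using that by (rule binomial_fact)
      ultimately show ?thesis by (simp add: co_def Beta_def mult_ac add_ac)
    qed
    moreover have "(D + D') ^ l = (\<Sum>i\<le>l. of_nat (l choose i) * D ^ i * D' ^ (l - i))"
      by (rule binomial_ring)
    ultimately have "(\<Sum>i\<le>l. co l i * (x powr (a + a' + real l - 1) * Beta (a + real i) (a' + real (l - i)))) =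
       x powr (a + a' + real l - 1) / (fact l * Gamma (a + a' + real l)) * (D + D') ^ l"
      by (simp add: sum_distrib_left)
    also have "\<dots> = x powr (a + a' - 1) * (((d + d') * b * x) ^ l / (fact l * Gamma (a + a' + real l)))"
    proof -
      have "x powr (a + a' + real l - 1) = x powr (a + a' - 1) * x ^ l"
        using x powr_add[of x "a + a' - 1" "real l"] by (simp add: powr_realpow algebra_simps)
      moreover have "D + D' = (d + d') * b" by (simp add: D_def D'_def algebra_simps)
      ultimately show ?thesis by (simp add: power_mult_distrib)
    qed
    finally have eq: "(\<Sum>i\<le>l. co l i * (x powr (a + a' + real l - 1) * Beta (a + real i) (a' + real (l - i)))) =
       x powr (a + a' - 1) * (((d + d') * b * x) ^ l / (fact l * Gamma (a + a' + real l)))" .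
    have Be: "Beta (a + real i) (a' + real j) \<ge> 0" for i j
      using a by (auto simp: Beta_def intro!: divide_nonneg_nonneg mult_nonneg_nonneg less_imp_le Gamma_real_pos)
    show ?thesis
      unfolding eq[symmetric] using co Be
      by (simp add: ennreal_mult[symmetric] del: of_nat_diff)
  qed
  \<comment> \<open>All terms are nonnegative, so sums and integral are exchanged in
    \<open>ennreal\<close> without an integrability condition.\<close>
  have "(\<integral>\<^sup>+y. ennreal (nc_gamma_density a b d (x - y)) * ennreal (nc_gamma_density a' b d' y) \<partial>lborel) =
     ennreal K * (\<Sum>l. \<Sum>i\<le>l. ennreal (co l i) * (\<integral>\<^sup>+y. ennreal (w l i y) \<partial>lborel))"
    unfolding pointwise
    by (simp add: nn_integral_cmult nn_integral_suminf nn_integral_sum)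
  also have "\<dots> = ennreal K * (\<Sum>l. ennreal (x powr (a + a' - 1) * (((d + d') * b * x) ^ l / (fact l * Gamma (a + a' + real l)))))"
    by (simp add: int_w coeff del: of_nat_diff)
  also have "(\<Sum>l. ennreal (x powr (a + a' - 1) * (((d + d') * b * x) ^ l / (fact l * Gamma (a + a' + real l))))) =
     ennreal (x powr (a + a' - 1) * bessel_series (a + a') ((d + d') * b * x))"
  proof (rule suminf_ennreal_eq)
    show "0 \<le> x powr (a + a' - 1) * (((d + d') * b * x) ^ l / (fact l * Gamma (a + a' + real l)))" for l
      using a b d x by (auto intro!: divide_nonneg_nonneg mult_nonneg_nonneg less_imp_le Gamma_real_pos)
    show "(\<lambda>l. x powr (a + a' - 1) * (((d + d') * b * x) ^ l / (fact l * Gamma (a + a' + real l))))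
       sums (x powr (a + a' - 1) * bessel_series (a + a') ((d + d') * b * x))"
      unfolding bessel_series_def using a by (intro sums_mult summable_sums summable_bessel_series) auto
  qed
  also have "ennreal K * \<dots> = ennreal (nc_gamma_density (a + a') b (d + d') x)"
    using x a b d K by (simp add: nc_gamma_density_def K_def ennreal_mult[symmetric] bessel_series_nonneg mult_ac)
  finally show ?thesis .
qed

section \<open>Squares of normal variables\<close>

text \<open>The substitution is applied on the compact intervals \<open>{0..real n}\<close>, whose
  images exhaust the half-line; both sides then pass to the limit by monotone convergence.\<close>

lemma nn_integral_square_substitution:
  fixes f :: "real \<Rightarrow> real"
  assumes [measurable]: "f \<in> borel_measurable borel" and k: "k > 0"
  shows "(\<integral>\<^sup>+x. ennreal (f x * indicator {0..} x) \<partial>lborel) =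
    (\<integral>\<^sup>+w. ennreal (f (k * w\<^sup>2) * (2 * k * w) * indicator {0..} w) \<partial>lborel)"
proof -
  have SUP_cut: "(\<integral>\<^sup>+x. ennreal (g x * indicator {0..} x) \<partial>lborel) =
      (SUP n. \<integral>\<^sup>+x. ennreal (g x * indicator {0..c n} x) \<partial>lborel)"
    if [measurable]: "g \<in> borel_measurable borel" and c: "incseq c" "\<And>x. \<exists>n. x \<le> c n"
    for g c :: "_ \<Rightarrow> real"
  proof -
    have "(SUP n. ennreal (g x * indicator {0..c n} x)) = ennreal (g x * indicator {0..} x)" for x
    proof (rule antisym)
      show "(SUP n. ennreal (g x * indicator {0..c n} x)) \<le> ennreal (g x * indicator {0..} x)"
        by (rule SUP_least) (auto simp: indicator_def)
      obtain n where "x \<le> c n" using c(2) by auto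
      then have "ennreal (g x * indicator {0..} x) = ennreal (g x * indicator {0..c n} x)"
        by (auto simp: indicator_def)
      then show "ennreal (g x * indicator {0..} x) \<le> (SUP n. ennreal (g x * indicator {0..c n} x))"
        by (simp only:) (rule SUP_upper, simp)
    qed
    moreover have "incseq (\<lambda>n x. ennreal (g x * indicator {0..c n} x))"
      using c(1) by (fastforce simp: incseq_def le_fun_def indicator_def intro: order_trans)
    ultimately show ?thesis
      by (subst nn_integral_monotone_convergence_SUP[symmetric]) auto
  qed
  have large: "\<exists>n. x \<le> k * (real n)\<^sup>2" for x
  proof -
    obtain n where n: "x / k \<le> real n" using real_arch_simple by blast
    have "real n \<le> (real n)\<^sup>2" by (cases n) (auto simp: power2_eq_square)
    then have "x / k \<le> (real n)\<^sup>2" using n by linarith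
    then show ?thesis using k by (auto simp: field_simps)
  qed
  have "(\<integral>\<^sup>+x. ennreal (f x * indicator {0..} x) \<partial>lborel) =
     (SUP n. \<integral>\<^sup>+x. ennreal (f x * indicator {0..k * (real n)\<^sup>2} x) \<partial>lborel)"
    using k large by (intro SUP_cut) (auto simp: incseq_def intro!: power_mono)
  also have "\<dots> = (SUP n. \<integral>\<^sup>+w. ennreal (f (k * w\<^sup>2) * (2 * k * w) * indicator {0..real n} w) \<partial>lborel)"
  proof (rule SUP_cong[OF refl])
    fix n :: nat
    show "(\<integral>\<^sup>+x. ennreal (f x * indicator {0..k * (real n)\<^sup>2} x) \<partial>lborel) =
       (\<integral>\<^sup>+w. ennreal (f (k * w\<^sup>2) * (2 * k * w) * indicator {0..real n} w) \<partial>lborel)"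
    proof -
      have "((\<lambda>w. k * w\<^sup>2) has_real_derivative 2 * k * x) (at x)" for x
        by (auto intro!: derivative_eq_intros)
      then show ?thesis
        using nn_integral_substitution[of "\<lambda>w. k * w\<^sup>2" 0 "real n" f "\<lambda>w. 2 * k * w"] k
        by (auto intro!: continuous_intros simp: set_borel_measurable_def)
    qed
  qed
  also have "\<dots> = (\<integral>\<^sup>+w. ennreal (f (k * w\<^sup>2) * (2 * k * w) * indicator {0..} w) \<partial>lborel)"
    using real_arch_simple by (intro SUP_cut[symmetric]) (auto simp: incseq_def)
  finally show ?thesis .
qed

text \<open>The point \<open>k * w\<^sup>2\<close> has the two preimages \<open>w\<close> and
  \<open>- w\<close>, and \<open>2 * k * w\<close> is the derivative there. Expanding the squares in
  the normal exponents leaves the cross terms \<open>exp (m * w / s\<^sup>2)\<close> and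
  \<open>exp (- (m * w / s\<^sup>2))\<close>, whose sum is the hyperbolic cosine given by the series
  with parameter 1/2.\<close>

lemma nc_gamma_density_half_square:
  assumes s: "s > 0" and k: "k > 0" and w: "w > 0"
  shows "nc_gamma_density (1/2) (1 / (2 * s\<^sup>2 * k)) (m\<^sup>2 / (2 * s\<^sup>2)) (k * w\<^sup>2) * (2 * k * w) =
    normal_density m s w + normal_density m s (- w)"
proof -
  have "m\<^sup>2 / (2 * s\<^sup>2) * (1 / (2 * s\<^sup>2 * k)) * (k * w\<^sup>2) = (m * w / (2 * s\<^sup>2))\<^sup>2"
    using k by (simp add: power2_eq_square field_simps)
  then have series: "bessel_series (1/2) (m\<^sup>2 / (2 * s\<^sup>2) * (1 / (2 * s\<^sup>2 * k)) * (k * w\<^sup>2)) =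
      (exp (m * w / s\<^sup>2) + exp (- (m * w / s\<^sup>2))) / (2 * sqrt pi)"
    by (simp only: bessel_series_half cosh_field_def) simp
  have p1: "(1 / (2 * s\<^sup>2 * k)) powr (1/2) = 1 / (s * (sqrt 2 * sqrt k))"
    using s k by (simp add: powr_half_sqrt real_sqrt_mult real_sqrt_divide)
  have p2: "(k * w\<^sup>2) powr (1/2 - 1) = 1 / (sqrt k * w)"
  proof -
    have "(1/2 - 1 :: real) = - (1/2)" by simp
    then have "(k * w\<^sup>2) powr (1/2 - 1) = inverse ((k * w\<^sup>2) powr (1/2))"
      by (simp only: powr_minus)
    also have "(k * w\<^sup>2) powr (1/2) = sqrt k * w"
      using k w by (subst powr_half_sqrt) (auto simp: real_sqrt_mult)
    finally show ?thesis by (simp only: divide_inverse mult_1_left)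
  qed
  have alg: "1 / (s * (t * q)) * (1 / (q * w)) * (2 * (q * q) * w) = 2 / (s * t)" if "t > 0" "q > 0" for t q
    using s w that by simp
  have "1 / (s * (sqrt 2 * sqrt k)) * (1 / (sqrt k * w)) * (2 * (sqrt k * sqrt k) * w) = 2 / (s * sqrt 2)"
    by (rule alg) (use k in auto)
  moreover have "sqrt k * sqrt k = k" using k by simp
  ultimately have pref: "(1 / (2 * s\<^sup>2 * k)) powr (1/2) * (k * w\<^sup>2) powr (1/2 - 1) * (2 * k * w) = 2 / (s * sqrt 2)"
    by (simp only: p1 p2)
  have e: "exp (- (1 / (2 * s\<^sup>2 * k)) * (k * w\<^sup>2) - m\<^sup>2 / (2 * s\<^sup>2)) * exp (m * w / s\<^sup>2) = exp (- (w - m)\<^sup>2 / (2 * s\<^sup>2))"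
    "exp (- (1 / (2 * s\<^sup>2 * k)) * (k * w\<^sup>2) - m\<^sup>2 / (2 * s\<^sup>2)) * exp (- (m * w / s\<^sup>2)) = exp (- (- w - m)\<^sup>2 / (2 * s\<^sup>2))"
    using s k by (simp_all add: exp_add[symmetric] power2_eq_square field_simps)
  have "nc_gamma_density (1/2) (1 / (2 * s\<^sup>2 * k)) (m\<^sup>2 / (2 * s\<^sup>2)) (k * w\<^sup>2) * (2 * k * w) =
    ((1 / (2 * s\<^sup>2 * k)) powr (1/2) * (k * w\<^sup>2) powr (1/2 - 1) * (2 * k * w)) *
    (exp (- (1 / (2 * s\<^sup>2 * k)) * (k * w\<^sup>2) - m\<^sup>2 / (2 * s\<^sup>2)) *
    ((exp (m * w / s\<^sup>2) + exp (- (m * w / s\<^sup>2))) / (2 * sqrt pi)))"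
    unfolding nc_gamma_density_def series using k w by simp
  also have "\<dots> = 2 / (s * sqrt 2) * ((exp (- (w - m)\<^sup>2 / (2 * s\<^sup>2)) + exp (- (- w - m)\<^sup>2 / (2 * s\<^sup>2))) / (2 * sqrt pi))"
    unfolding pref e[symmetric] by (simp only: distrib_left times_divide_eq_right)
  also have "\<dots> = normal_density m s w + normal_density m s (- w)"
    using s by (simp add: normal_density_def real_sqrt_mult add_divide_distrib mult_ac)
  finally show ?thesis .
qed

text \<open>The negative half-line is folded onto the positive one, so that the integrand becomes
  the sum of the normal density at \<open>w\<close> and \<open>- w\<close>; substituting the square
  then finishes the comparison on each Borel set.\<close>

lemma distr_square_normal_density:
  assumes s: "s > 0" and k: "k > 0"
  shows "distr (density lborel (normal_density m s)) borel (\<lambda>w. k * w\<^sup>2) =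
    density lborel (nc_gamma_density (1/2) (1 / (2 * s\<^sup>2 * k)) (m\<^sup>2 / (2 * s\<^sup>2)))"
proof (rule measure_eqI)
  define G where "G = nc_gamma_density (1/2) (1 / (2 * s\<^sup>2 * k)) (m\<^sup>2 / (2 * s\<^sup>2))"
  define f where "f = normal_density m s"
  have [measurable]: "G \<in> borel_measurable borel" unfolding G_def by measurable
  have G0: "G x = 0" if "x \<le> 0" for x using that by (simp add: G_def nc_gamma_density_def)
  have [measurable]: "f \<in> borel_measurable borel" and f: "f w \<ge> 0" for w
    by (auto simp: f_def)
  fix A assume "A \<in> sets (distr (density lborel (normal_density m s)) borel (\<lambda>w. k * w\<^sup>2))"
  then have [measurable]: "A \<in> sets borel" by simp
  have "emeasure (distr (density lborel f) borel (\<lambda>w. k * w\<^sup>2)) A =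
      (\<integral>\<^sup>+w. ennreal (f w) * indicator A (k * w\<^sup>2) \<partial>lborel)"
  proof -
    have "{w. k * w\<^sup>2 \<in> A} \<in> sets borel" by measurable
    then show ?thesis by (simp add: emeasure_distr emeasure_density vimage_def indicator_def)
  qed
  also have "\<dots> = (\<integral>\<^sup>+w. ennreal (f w) * indicator A (k * w\<^sup>2) * indicator {0..} w
      + ennreal (f w) * indicator A (k * w\<^sup>2) * indicator {..<0} w \<partial>lborel)"
    by (intro nn_integral_cong) (auto simp: indicator_def)
  also have "\<dots> = (\<integral>\<^sup>+w. ennreal (f w) * indicator A (k * w\<^sup>2) * indicator {0..} w \<partial>lborel)
      + (\<integral>\<^sup>+w. ennreal (f w) * indicator A (k * w\<^sup>2) * indicator {..<0} w \<partial>lborel)"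
    by (intro nn_integral_add) auto
  also have "(\<integral>\<^sup>+w. ennreal (f w) * indicator A (k * w\<^sup>2) * indicator {..<0} w \<partial>lborel) =
      (\<integral>\<^sup>+w. ennreal (f (- w)) * indicator A (k * w\<^sup>2) * indicator {..<0} (- w) \<partial>lborel)"
    by (subst nn_integral_real_affine[where c="-1" and t=0]) auto
  also have "\<dots> = (\<integral>\<^sup>+w. ennreal (f (- w)) * indicator A (k * w\<^sup>2) * indicator {0..} w \<partial>lborel)"
    \<comment> \<open>Reflection turns \<open>{..<0}\<close> into the open half-line, which differs
      from \<open>{0..}\<close> by a null set.\<close>
    using AE_lborel_singleton[of "0::real"]
    by (intro nn_integral_cong_AE) (auto simp: indicator_def elim!: eventually_mono)
  also have "(\<integral>\<^sup>+w. ennreal (f w) * indicator A (k * w\<^sup>2) * indicator {0..} w \<partial>lborel) + \<dots> =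
      (\<integral>\<^sup>+w. ennreal (f w) * indicator A (k * w\<^sup>2) * indicator {0..} w +
        ennreal (f (- w)) * indicator A (k * w\<^sup>2) * indicator {0..} w \<partial>lborel)"
    by (intro nn_integral_add[symmetric]) auto
  also have "\<dots> = (\<integral>\<^sup>+w. ennreal ((indicator A (k * w\<^sup>2) * G (k * w\<^sup>2)) * (2 * k * w) * indicator {0..} w) \<partial>lborel)"
    using AE_lborel_singleton[of "0::real"]
  proof (intro nn_integral_cong_AE, eventually_elim)
    fix w :: real assume "w \<noteq> 0"
    then show "ennreal (f w) * indicator A (k * w\<^sup>2) * indicator {0..} w +
        ennreal (f (- w)) * indicator A (k * w\<^sup>2) * indicator {0..} w =
        ennreal ((indicator A (k * w\<^sup>2) * G (k * w\<^sup>2)) * (2 * k * w) * indicator {0..} w)"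
      using nc_gamma_density_half_square[OF s k, of w m] f
      by (cases "w > 0") (auto simp: indicator_def f_def G_def)
  qed
  also have "\<dots> = (\<integral>\<^sup>+x. ennreal ((indicator A x * G x) * indicator {0..} x) \<partial>lborel)"
    by (rule nn_integral_square_substitution[symmetric]) (use k in auto)
  also have "\<dots> = (\<integral>\<^sup>+x. ennreal (G x) * indicator A x \<partial>lborel)"
    by (intro nn_integral_cong) (auto simp: indicator_def G0 not_le)
  also have "\<dots> = emeasure (density lborel G) A"
    by (subst emeasure_density) auto
  finally show "emeasure (distr (density lborel (normal_density m s)) borel (\<lambda>w. k * w\<^sup>2)) A =
      emeasure (density lborel (nc_gamma_density (1/2) (1 / (2 * s\<^sup>2 * k)) (m\<^sup>2 / (2 * s\<^sup>2)))) A"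
    by (simp add: G_def f_def)
qed simp

section \<open>Linear changes of variables: reflection and rotation\<close>

lemma distr_uminus_density:
  fixes f :: "real \<Rightarrow> ennreal"
  assumes [measurable]: "f \<in> borel_measurable borel"
  shows "distr (density lborel f) borel uminus = density lborel (\<lambda>x. f (- x))"
proof (rule measure_eqI)
  fix A assume "A \<in> sets (distr (density lborel f) borel uminus)"
  then have [measurable]: "A \<in> sets borel" by simp
  have "emeasure (distr (density lborel f) borel uminus) A = (\<integral>\<^sup>+x. f x * indicator A (- x) \<partial>lborel)"
  proof -
    have "(\<lambda>x::real. - x) -` A \<in> sets borel"
      by (rule measurable_sets_borel[of _ borel]) measurable
    then show ?thesis by (simp add: emeasure_distr emeasure_density indicator_vimage)
  qed
  also have "\<dots> = (\<integral>\<^sup>+x. f (- x) * indicator A x \<partial>lborel)"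
    by (subst nn_integral_real_affine[where c="-1" and t=0]) auto
  finally show "emeasure (distr (density lborel f) borel uminus) A = emeasure (density lborel (\<lambda>x. f (- x))) A"
    by (simp add: emeasure_density)
qed simp

text \<open>The coordinates are \<open>w = x / sX + y / sY\<close> and
  \<open>w' = x / sX - y / sY\<close>. They are uncorrelated for every \<open>r\<close> because the
  standardized variables have equal variance; hence the quadratic form loses its mixed term, and the
  variances are \<open>2 * (1 + r)\<close> and \<open>2 * (1 - r)\<close>. The factor
  \<open>sX * sY / 2\<close> is the Jacobian.\<close>

lemma bivariate_normal_density_rotate:
  assumes sX: "sX > 0" and sY: "sY > 0" and r: "-1 < r" "r < 1"
  shows "sX * sY / 2 * bivariate_normal_density mX mY sX sY r (sX * (w + w') / 2, sY * (w - w') / 2) =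
    normal_density (mX / sX + mY / sY) (sqrt (2 * (1 + r))) w *
    normal_density (mX / sX - mY / sY) (sqrt (2 * (1 - r))) w'"
proof -
  define u v where "u = w - (mX / sX + mY / sY)" and "v = w' - (mX / sX - mY / sY)"
  have r2: "1 - r\<^sup>2 = (1 + r) * (1 - r)" by (simp add: power2_eq_square algebra_simps)
  have x: "(sX * (w + w') / 2 - mX) / sX = (u + v) / 2"
    using sX by (simp add: u_def v_def field_simps)
  have y: "(sY * (w - w') / 2 - mY) / sY = (u - v) / 2"
    using sY by (simp add: u_def v_def field_simps)
  have "- (((u + v) / 2)\<^sup>2 - 2 * r * ((u + v) / 2) * ((u - v) / 2) + ((u - v) / 2)\<^sup>2) / (2 * (1 - r\<^sup>2)) =
      - u\<^sup>2 / (2 * (2 * (1 + r))) + - v\<^sup>2 / (2 * (2 * (1 - r)))"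
  proof -
    have "((u + v) / 2)\<^sup>2 - 2 * r * ((u + v) / 2) * ((u - v) / 2) + ((u - v) / 2)\<^sup>2 =
        (u\<^sup>2 * (1 - r) + v\<^sup>2 * (1 + r)) / 2"
      by (simp add: power2_eq_square field_simps)
    then show ?thesis
      unfolding r2 using r by (simp add: add_divide_distrib diff_divide_distrib)
  qed
  then have e: "exp (- (((u + v) / 2)\<^sup>2 - 2 * r * ((u + v) / 2) * ((u - v) / 2) + ((u - v) / 2)\<^sup>2) / (2 * (1 - r\<^sup>2))) =
      exp (- u\<^sup>2 / (2 * (2 * (1 + r)))) * exp (- v\<^sup>2 / (2 * (2 * (1 - r))))"
    by (simp only: exp_add)
  have c: "sqrt (2 * pi * (2 * (1 + r))) * sqrt (2 * pi * (2 * (1 - r))) = 4 * pi * sqrt (1 - r\<^sup>2)"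
  proof -
    have "sqrt (2 * pi * (2 * (1 + r))) * sqrt (2 * pi * (2 * (1 - r))) = sqrt ((4 * pi)\<^sup>2 * (1 - r\<^sup>2))"
      unfolding r2 by (simp add: real_sqrt_mult[symmetric] power2_eq_square algebra_simps)
    then show ?thesis by (simp add: real_sqrt_mult)
  qed
  have "sX * sY / 2 * bivariate_normal_density mX mY sX sY r (sX * (w + w') / 2, sY * (w - w') / 2) =
     1 / (4 * pi * sqrt (1 - r\<^sup>2)) * (exp (- u\<^sup>2 / (2 * (2 * (1 + r)))) * exp (- v\<^sup>2 / (2 * (2 * (1 - r)))))"
    unfolding bivariate_normal_density_def case_prod_conv x y e using sX sY by simp
  then show ?thesis
    using r by (simp add: normal_density_def u_def v_def c[symmetric])
qed

text \<open>Two one-dimensional affine substitutions replace a planar one: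
  \<open>x = sX * y / sY + sX * w'\<close> at fixed \<open>y\<close>, then
  \<open>y = sY * (w - w') / 2\<close> at fixed \<open>w'\<close>. Fubini changes the variable held
  fixed, and the factors \<open>sX\<close> and \<open>sY / 2\<close> multiply to the
  Jacobian.\<close>

lemma nn_integral_rotate:
  fixes F :: "real \<times> real \<Rightarrow> ennreal"
  assumes [measurable]: "F \<in> borel_measurable (borel \<Otimes>\<^sub>M borel)"
    and sX: "sX > 0" and sY: "sY > 0"
  shows "(\<integral>\<^sup>+x. \<integral>\<^sup>+y. F (x, y) \<partial>lborel \<partial>lborel) =
    (\<integral>\<^sup>+w. \<integral>\<^sup>+w'. ennreal (sX * sY / 2) * F (sX * (w + w') / 2, sY * (w - w') / 2) \<partial>lborel \<partial>lborel)"
proof -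
  have "(\<integral>\<^sup>+x. \<integral>\<^sup>+y. F (x, y) \<partial>lborel \<partial>lborel) = (\<integral>\<^sup>+y. \<integral>\<^sup>+x. F (x, y) \<partial>lborel \<partial>lborel)"
    by (rule lborel_pair.Fubini') simp
  also have "\<dots> = (\<integral>\<^sup>+y. \<integral>\<^sup>+w'. ennreal sX * F (sX * y / sY + sX * w', y) \<partial>lborel \<partial>lborel)"
  proof (rule nn_integral_cong)
    fix y
    show "(\<integral>\<^sup>+x. F (x, y) \<partial>lborel) = (\<integral>\<^sup>+w'. ennreal sX * F (sX * y / sY + sX * w', y) \<partial>lborel)"
      using sX by (subst nn_integral_real_affine[where c=sX and t="sX * y / sY"])
        (auto simp: nn_integral_cmult)
  qed
  also have "\<dots> = (\<integral>\<^sup>+w'. \<integral>\<^sup>+y. ennreal sX * F (sX * y / sY + sX * w', y) \<partial>lborel \<partial>lborel)"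
    by (rule lborel_pair.Fubini') simp
  also have "\<dots> = (\<integral>\<^sup>+w'. \<integral>\<^sup>+w. ennreal (sX * sY / 2) * F (sX * (w + w') / 2, sY * (w - w') / 2) \<partial>lborel \<partial>lborel)"
  proof (rule nn_integral_cong)
    fix w'
    have eq: "- sY * w' / 2 + sY / 2 * w = sY * (w - w') / 2"
       "sX * (sY * (w - w') / 2) / sY + sX * w' = sX * (w + w') / 2" for w
      using sY by (simp_all add: field_simps)
    have "(\<integral>\<^sup>+y. ennreal sX * F (sX * y / sY + sX * w', y) \<partial>lborel) =
        ennreal (sY / 2) * (\<integral>\<^sup>+w. ennreal sX * F (sX * (w + w') / 2, sY * (w - w') / 2) \<partial>lborel)"
      using sY by (subst nn_integral_real_affine[where c="sY / 2" and t="- sY * w' / 2"])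
        (simp_all only: eq, auto)
    also have "\<dots> = (\<integral>\<^sup>+w. ennreal (sY / 2) * (ennreal sX * F (sX * (w + w') / 2, sY * (w - w') / 2)) \<partial>lborel)"
      by (rule nn_integral_cmult[symmetric]) simp
    also have "\<dots> = (\<integral>\<^sup>+w. ennreal (sX * sY / 2) * F (sX * (w + w') / 2, sY * (w - w') / 2) \<partial>lborel)"
    proof -
      have "ennreal (sX * sY / 2) = ennreal (sY / 2) * ennreal sX"
        using sX sY by (simp add: ennreal_mult[symmetric] mult.commute)
      then show ?thesis by (simp add: mult.assoc)
    qed
    finally show "(\<integral>\<^sup>+y. ennreal sX * F (sX * y / sY + sX * w', y) \<partial>lborel) =
       (\<integral>\<^sup>+w. ennreal (sX * sY / 2) * F (sX * (w + w') / 2, sY * (w - w') / 2) \<partial>lborel)" .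
  qed
  also have "\<dots> = (\<integral>\<^sup>+w. \<integral>\<^sup>+w'. ennreal (sX * sY / 2) * F (sX * (w + w') / 2, sY * (w - w') / 2) \<partial>lborel \<partial>lborel)"
    by (rule lborel_pair.Fubini') simp
  finally show ?thesis .
qed

section \<open>The law of the sum of products\<close>

text \<open>The total mass is found without integrating the series: shape 1/2 is the law of a
  squared normal variable, and each further half is added by convolution with a central law, which
  preserves mass one.\<close>

lemma prob_space_nc_gamma_density:
  assumes n: "n \<ge> 1" and b: "b > 0" and d: "d \<ge> 0"
  shows "prob_space (density lborel (nc_gamma_density (real n / 2) b d))"
proof -
  have half: "prob_space (density lborel (nc_gamma_density (1 / 2) b d))" if "d \<ge> 0" for d
  proof -
    \<comment> \<open>With \<open>s = 1\<close>, \<open>m = sqrt (2 * d)\<close> and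
      \<open>k = 1 / (2 * b)\<close>, the parameters \<open>1 / (2 * s\<^sup>2 * k)\<close> and
      \<open>m\<^sup>2 / (2 * s\<^sup>2)\<close> of the squared variable are \<open>b\<close> and
      \<open>d\<close>.\<close>
    have "prob_space (distr (density lborel (normal_density (sqrt (2 * d)) 1)) borel (\<lambda>w. 1 / (2 * b) * w\<^sup>2))"
      by (intro prob_space.prob_space_distr prob_space_normal_density) auto
    then show ?thesis
      using distr_square_normal_density[of 1 "1 / (2 * b)" "sqrt (2 * d)"] b that by simp
  qed
  show ?thesis
  using n d
proof (induction n rule: nat_induct_at_least)
  case base
  then show ?case using half by simp
next
  case (Suc n)
  have "prob_space (density lborel (\<lambda>x. \<integral>\<^sup>+y. ennreal (nc_gamma_density (real n / 2) b d (x - y)) *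
      ennreal (nc_gamma_density (1 / 2) b 0 y) \<partial>lborel))"
    using Suc.IH[OF Suc.prems] half[of 0] Suc.hyps
    by (intro prob_space_convolution_density) auto
  moreover have eq: "real (Suc n) / 2 = real n / 2 + 1 / 2" by (simp add: add_divide_distrib)
  ultimately show ?case
    unfolding eq using nc_gamma_density_convolution[of "real n / 2" "1/2" b d 0] Suc.hyps Suc.prems b by simp
  qed
qed

lemma reflect_nc_gamma_density_convolution:
  assumes a: "a > 0" "a' > 0" and b: "b > 0" and d: "d \<ge> 0" "d' \<ge> 0"
  shows "(\<integral>\<^sup>+y. ennreal (nc_gamma_density a b d (- (x - y))) * ennreal (nc_gamma_density a' b d' (- y)) \<partial>lborel) =
    ennreal (nc_gamma_density (a + a') b (d + d') (- x))"
proof -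
  have "(\<integral>\<^sup>+y. ennreal (nc_gamma_density a b d (- (x - y))) * ennreal (nc_gamma_density a' b d' (- y)) \<partial>lborel) =
     (\<integral>\<^sup>+y. ennreal (nc_gamma_density a b d (- x - y)) * ennreal (nc_gamma_density a' b d' y) \<partial>lborel)"
    using a by (subst nn_integral_real_affine[where c="-1" and t=0]) auto
  also have "\<dots> = ennreal (nc_gamma_density (a + a') b (d + d') (- x))"
    by (rule nc_gamma_density_convolution) fact+
  finally show ?thesis .
qed

abbreviation nc_gamma_measure :: "real \<Rightarrow> real \<Rightarrow> real \<Rightarrow> real measure" where
  "nc_gamma_measure a b d \<equiv> density lborel (\<lambda>x. ennreal (nc_gamma_density a b d x))"

abbreviation reflected_nc_gamma_measure :: "real \<Rightarrow> real \<Rightarrow> real \<Rightarrow> real measure" where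
  "reflected_nc_gamma_measure a b d \<equiv> density lborel (\<lambda>x. ennreal (nc_gamma_density a b d (- x)))"

text \<open>Only the joint density enters; no sum and difference variables are introduced on
  \<open>M\<close>. In the rotated coordinates the density factors and the product is a function of
  \<open>w\<close> plus a function of \<open>w'\<close>, so the integral of an indicator is the
  iterated integral that defines a convolution.\<close>

lemma distr_bivariate_normal_product:
  assumes XY: "bivariate_normal M X Y mX mY sX sY r"
    and sX: "sX > 0" and sY: "sY > 0" and r: "-1 < r" "r < 1"
  shows "distr M borel (\<lambda>\<omega>. X \<omega> * Y \<omega>) =
    (nc_gamma_measure (1/2) (1 / (sX * sY * (1 + r))) ((mX / sX + mY / sY)\<^sup>2 / (4 * (1 + r))) \<star>
    reflected_nc_gamma_measure (1/2) (1 / (sX * sY * (1 - r))) ((mX / sX - mY / sY)\<^sup>2 / (4 * (1 - r))))"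
    (is "_ = (?P \<star> ?Q)")
proof (rule measure_eqI)
  define f where "f = bivariate_normal_density mX mY sX sY r"
  define N where "N = normal_density (mX / sX + mY / sY) (sqrt (2 * (1 + r)))"
  define N' where "N' = normal_density (mX / sX - mY / sY) (sqrt (2 * (1 - r)))"
  \<comment> \<open>In the rotated coordinates
    \<open>x * y = sX * sY / 4 * (w\<^sup>2 - w'\<^sup>2)\<close>.\<close>
  define k where "k = sX * sY / 4"
  have k: "k > 0" using sX sY by (simp add: k_def)
  have [measurable]: "N \<in> borel_measurable borel" "N' \<in> borel_measurable borel"
    by (auto simp: N_def N'_def)
  have [measurable]: "f \<in> borel_measurable (borel \<Otimes>\<^sub>M borel)"
    unfolding f_def bivariate_normal_density_def by measurable
  have N_nonneg: "N w \<ge> 0" "N' w \<ge> 0" for w by (auto simp: N_def N'_def)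
  have D: "distributed M (lborel \<Otimes>\<^sub>M lborel) (\<lambda>\<omega>. (X \<omega>, Y \<omega>)) (\<lambda>p. ennreal (f p))"
    using XY by (simp add: bivariate_normal_def f_def)
  \<comment> \<open>These are the denominators of the rate \<open>1 / (2 * s\<^sup>2 * k)\<close>
    and the noncentrality \<open>m\<^sup>2 / (2 * s\<^sup>2)\<close> of a squared normal variable,
    for the variances \<open>2 * (1 + r)\<close> and \<open>2 * (1 - r)\<close>.\<close>
  have params: "2 * (sqrt (2 * (1 + r)))\<^sup>2 * k = sX * sY * (1 + r)" "2 * (sqrt (2 * (1 + r)))\<^sup>2 = 4 * (1 + r)"
    "2 * (sqrt (2 * (1 - r)))\<^sup>2 * k = sX * sY * (1 - r)" "2 * (sqrt (2 * (1 - r)))\<^sup>2 = 4 * (1 - r)"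
    using r by (simp_all add: k_def)
  have P: "?P = distr (density lborel N) borel (\<lambda>w. k * w\<^sup>2)"
    unfolding N_def using distr_square_normal_density[of "sqrt (2 * (1 + r))" k "mX / sX + mY / sY", unfolded params(1), unfolded params(2)] k r by simp
  have Q': "distr (density lborel N') borel (\<lambda>w. k * w\<^sup>2) =
     nc_gamma_measure (1/2) (1 / (sX * sY * (1 - r))) ((mX / sX - mY / sY)\<^sup>2 / (4 * (1 - r)))"
    unfolding N'_def using distr_square_normal_density[of "sqrt (2 * (1 - r))" k "mX / sX - mY / sY", unfolded params(3), unfolded params(4)] k r by simp
  have Q: "?Q = distr (density lborel N') borel (\<lambda>w. - (k * w\<^sup>2))"
  proof -
    have "?Q = distr (distr (density lborel N') borel (\<lambda>w. k * w\<^sup>2)) borel uminus"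
      unfolding Q' by (subst distr_uminus_density) auto
    then show ?thesis by (simp add: distr_distr o_def)
  qed
  have fin: "finite_measure ?P" "finite_measure ?Q"
    unfolding P Q N_def N'_def using r
    by (auto intro!: prob_space.finite_measure prob_space.prob_space_distr prob_space_normal_density)
  show "sets (distr M borel (\<lambda>\<omega>. X \<omega> * Y \<omega>)) = sets (?P \<star> ?Q)" by simp
  fix A assume "A \<in> sets (distr M borel (\<lambda>\<omega>. X \<omega> * Y \<omega>))"
  then have [measurable]: "A \<in> sets borel" by simp
  have [measurable]: "(\<lambda>\<omega>. (X \<omega>, Y \<omega>)) \<in> measurable M (borel \<Otimes>\<^sub>M borel)"
    using distributed_measurable[OF D] by (simp cong: measurable_cong_sets)
  have "distr M borel (\<lambda>\<omega>. X \<omega> * Y \<omega>) =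
      distr (distr M (lborel \<Otimes>\<^sub>M lborel) (\<lambda>\<omega>. (X \<omega>, Y \<omega>))) borel (\<lambda>p. fst p * snd p)"
    using distributed_measurable[OF D] by (subst distr_distr) (auto simp: o_def)
  also have "\<dots> = distr (density (lborel \<Otimes>\<^sub>M lborel) (\<lambda>p. ennreal (f p))) borel (\<lambda>p. fst p * snd p)"
    using distributed_distr_eq_density[OF D] by simp
  finally have "emeasure (distr M borel (\<lambda>\<omega>. X \<omega> * Y \<omega>)) A =
      (\<integral>\<^sup>+z. indicator A z \<partial>distr (density (lborel \<Otimes>\<^sub>M lborel) (\<lambda>p. ennreal (f p))) borel (\<lambda>p. fst p * snd p))"
    by (subst nn_integral_indicator) auto
  also have "\<dots> = (\<integral>\<^sup>+p. ennreal (f p) * indicator A (fst p * snd p) \<partial>(lborel \<Otimes>\<^sub>M lborel))"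
    by (simp add: nn_integral_distr nn_integral_density del: nn_integral_indicator)
  also have "\<dots> = (\<integral>\<^sup>+x. \<integral>\<^sup>+y. ennreal (f (x, y)) * indicator A (x * y) \<partial>lborel \<partial>lborel)"
    by (subst lborel.nn_integral_fst[symmetric]) auto
  also have "\<dots> = (\<integral>\<^sup>+w. \<integral>\<^sup>+w'. ennreal (sX * sY / 2) * (ennreal (f (sX * (w + w') / 2, sY * (w - w') / 2)) *
      indicator A ((sX * (w + w') / 2) * (sY * (w - w') / 2))) \<partial>lborel \<partial>lborel)"
    using nn_integral_rotate[of "\<lambda>p. ennreal (f p) * indicator A (fst p * snd p)", OF _ sX sY] by simp
  also have "\<dots> = (\<integral>\<^sup>+w. \<integral>\<^sup>+w'. ennreal (N w) * (ennreal (N' w') * indicator A (k * w\<^sup>2 + - (k * w'\<^sup>2))) \<partial>lborel \<partial>lborel)"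
  proof (intro nn_integral_cong)
    fix w w'
    have a: "(sX * (w + w') / 2) * (sY * (w - w') / 2) = k * w\<^sup>2 + - (k * w'\<^sup>2)"
      by (simp add: k_def power2_eq_square field_simps)
    have b: "ennreal (sX * sY / 2) * ennreal (f (sX * (w + w') / 2, sY * (w - w') / 2)) = ennreal (N w) * ennreal (N' w')"
      using bivariate_normal_density_rotate[OF sX sY r, of mX mY w w'] sX sY N_nonneg
      by (simp add: f_def N_def N'_def ennreal_mult'[symmetric])
    show "ennreal (sX * sY / 2) * (ennreal (f (sX * (w + w') / 2, sY * (w - w') / 2)) *
      indicator A ((sX * (w + w') / 2) * (sY * (w - w') / 2))) =
      ennreal (N w) * (ennreal (N' w') * indicator A (k * w\<^sup>2 + - (k * w'\<^sup>2)))"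
      unfolding a by (simp only: mult.assoc[symmetric] b)
  qed
  also have "\<dots> = (\<integral>\<^sup>+w. ennreal (N w) * (\<integral>\<^sup>+w'. ennreal (N' w') * indicator A (k * w\<^sup>2 + - (k * w'\<^sup>2)) \<partial>lborel) \<partial>lborel)"
    by (intro nn_integral_cong nn_integral_cmult) simp
  also have "\<dots> = (\<integral>\<^sup>+x. \<integral>\<^sup>+w'. ennreal (N' w') * indicator A (x + - (k * w'\<^sup>2)) \<partial>lborel \<partial>?P)"
    unfolding P by (simp add: nn_integral_distr nn_integral_density)
  also have "\<dots> = (\<integral>\<^sup>+x. \<integral>\<^sup>+y. indicator A (x + y) \<partial>?Q \<partial>?P)"
    unfolding Q by (simp add: nn_integral_distr nn_integral_density)
  also have "\<dots> = emeasure (?P \<star> ?Q) A"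
    using fin by (intro convolution_emeasure'[symmetric]) auto
  finally show "emeasure (distr M borel (\<lambda>\<omega>. X \<omega> * Y \<omega>)) A = emeasure (?P \<star> ?Q) A" .
qed

lemma prob_space_reflected_nc_gamma_measure:
  assumes "n \<ge> 1" "b > 0" "d \<ge> 0"
  shows "prob_space (reflected_nc_gamma_measure (real n / 2) b d)"
proof -
  have "prob_space (distr (nc_gamma_measure (real n / 2) b d) borel uminus)"
    using assms by (intro prob_space.prob_space_distr prob_space_nc_gamma_density) auto
  then show ?thesis using assms by (simp add: distr_uminus_density)
qed

text \<open>Regroups a sum of two differences into the positive parts together and the negative
  parts together, so that only laws with equal rate get convolved with each other.\<close>

lemma convolution_interchange:
  assumes [simp]: "finite_measure A" "finite_measure B" "finite_measure C" "finite_measure D"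
    and [simp, measurable_cong]: "sets A = sets borel" "sets B = sets borel" "sets C = sets borel" "sets D = sets borel"
  shows "((A \<star> B) \<star> (C \<star> D)) = ((A \<star> C) \<star> (B \<star> D))"
proof -
  have "((A \<star> B) \<star> (C \<star> D)) = (A \<star> (B \<star> (C \<star> D)))"
    by (simp add: convolution_associative convolution_finite)
  also have "(B \<star> (C \<star> D)) = (C \<star> (B \<star> D))"
    by (simp add: convolution_associative convolution_commutative[of B C])
  finally show ?thesis
    by (simp add: convolution_associative convolution_finite)
qed

text \<open>The induction starts at a single index, since an empty sum is a point mass at 0 and has
  no density. In the step, independence turns the added variable into a convolution factor, and
  regrouping lets equal rates meet.\<close>

lemma (in prob_space) distr_sum_nc_gamma_difference:
  assumes "finite I" "I \<noteq> {}" "indep_vars (\<lambda>_. borel) Z I"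
    and "\<And>i. i \<in> I \<Longrightarrow> distr M borel (Z i) =
      (nc_gamma_measure (1/2) b d \<star> reflected_nc_gamma_measure (1/2) b' d')"
    and b: "b > 0" "b' > 0" and d: "d \<ge> 0" "d' \<ge> 0"
  shows "distr M borel (\<lambda>\<omega>. \<Sum>i\<in>I. Z i \<omega>) =
    (nc_gamma_measure (real (card I) / 2) b (real (card I) * d) \<star>
    reflected_nc_gamma_measure (real (card I) / 2) b' (real (card I) * d'))"
  using assms(1-4)
proof (induction I rule: finite_ne_induct)
  case (singleton i)
  then show ?case by simp
next
  case (insert i I)
  define n where "n = card I"
  have n: "n \<ge> 1" using insert.hyps by (simp add: n_def Suc_leI card_gt_0_iff)
  have fin: "finite_measure (nc_gamma_measure (1/2) b d)"
    "finite_measure (reflected_nc_gamma_measure (1/2) b' d')"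
    "finite_measure (nc_gamma_measure (real n / 2) b (real n * d))"
    "finite_measure (reflected_nc_gamma_measure (real n / 2) b' (real n * d'))"
    using prob_space_nc_gamma_density[of 1 b d] prob_space_reflected_nc_gamma_measure[of 1 b' d']
      prob_space_nc_gamma_density[of n b "real n * d"] prob_space_reflected_nc_gamma_measure[of n b' "real n * d'"]
      n b d by (auto intro: prob_space.finite_measure)
  have rv: "random_variable borel (Z j)" if "j \<in> insert i I" for j
    using insert.prems(1) that by (auto simp: indep_vars_def)
  have "distr M borel (\<lambda>\<omega>. \<Sum>j\<in>insert i I. Z j \<omega>) = distr M borel (\<lambda>\<omega>. Z i \<omega> + (\<Sum>j\<in>I. Z j \<omega>))"
    using insert.hyps by simp
  also have "\<dots> = (distr M borel (Z i) \<star> distr M borel (\<lambda>\<omega>. \<Sum>j\<in>I. Z j \<omega>))"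
    using insert.hyps insert.prems rv
    by (intro sum_indep_random_variable indep_vars_sum borel_measurable_sum) auto
  also have "distr M borel (\<lambda>\<omega>. \<Sum>j\<in>I. Z j \<omega>) =
    (nc_gamma_measure (real n / 2) b (real n * d) \<star> reflected_nc_gamma_measure (real n / 2) b' (real n * d'))"
    unfolding n_def using insert.prems by (intro insert.IH) (auto intro: indep_vars_subset)
  also have "distr M borel (Z i) = (nc_gamma_measure (1/2) b d \<star> reflected_nc_gamma_measure (1/2) b' d')"
    using insert.prems by simp
  also have "((nc_gamma_measure (1/2) b d \<star> reflected_nc_gamma_measure (1/2) b' d') \<star>
      (nc_gamma_measure (real n / 2) b (real n * d) \<star> reflected_nc_gamma_measure (real n / 2) b' (real n * d'))) =
    ((nc_gamma_measure (1/2) b d \<star> nc_gamma_measure (real n / 2) b (real n * d)) \<star>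
      (reflected_nc_gamma_measure (1/2) b' d' \<star> reflected_nc_gamma_measure (real n / 2) b' (real n * d')))"
    using fin by (intro convolution_interchange) auto
  also have "(nc_gamma_measure (1/2) b d \<star> nc_gamma_measure (real n / 2) b (real n * d)) =
     nc_gamma_measure (1/2 + real n / 2) b (d + real n * d)"
    using fin n b d by (subst convolution_density) (auto simp: nc_gamma_density_convolution)
  also have "(reflected_nc_gamma_measure (1/2) b' d' \<star> reflected_nc_gamma_measure (real n / 2) b' (real n * d')) =
     reflected_nc_gamma_measure (1/2 + real n / 2) b' (d' + real n * d')"
    using fin n b d reflect_nc_gamma_density_convolution[of "1/2" "real n / 2" b' d' "real n * d'"]
    by (subst convolution_density) auto
  also have "1/2 + real n / 2 = real (card (insert i I)) / 2"
    using insert.hyps by (simp add: n_def add_divide_distrib)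
  also have "d + real n * d = real (card (insert i I)) * d"
    using insert.hyps by (simp add: n_def algebra_simps)
  also have "d' + real n * d' = real (card (insert i I)) * d'"
    using insert.hyps by (simp add: n_def algebra_simps)
  finally show ?case .
qed

section \<open>The density of a difference of noncentral Gamma variables\<close>

text \<open>This is \<open>t \<le> exp t\<close> at \<open>t = k * p / s\<close>, raised to the
  power \<open>s\<close>.\<close>

lemma powr_le_exp:
  fixes p s k :: real
  assumes "s > 0" "k > 0" "p > 0"
  shows "p powr s \<le> (s / k) powr s * exp (k * p)"
proof -
  have "p powr s = ((s / k) * (k * p / s)) powr s" using assms by simp
  also have "\<dots> = (s / k) powr s * (k * p / s) powr s"
    by (rule powr_mult)
  also have "(k * p / s) powr s \<le> exp (k * p / s) powr s"
  proof (intro powr_mono2)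
    show "k * p / s \<le> exp (k * p / s)" using exp_ge_add_one_self[of "k * p / s"] by linarith
  qed (use assms in auto)
  also have "exp (k * p / s) powr s = exp (k * p)"
    using assms by (simp add: powr_def)
  finally show ?thesis by (simp add: mult_left_mono)
qed

text \<open>The bound stays away from 0 because for \<open>a < 1\<close> the density is unbounded
  there. The decay \<open>exp (- b * p)\<close> is spent in two halves, one on the Bessel series and
  one on the power of \<open>p\<close>.\<close>

lemma nc_gamma_density_bounded:
  assumes a: "a > 0" and b: "b > 0" and d: "d \<ge> 0" and x: "x > 0"
  shows "\<exists>C\<ge>0. \<forall>p\<ge>x. nc_gamma_density a b d p \<le> C"
proof -
  \<comment> \<open>At the argument \<open>d * b * p\<close> this exponent is
    \<open>b / 2 * p\<close> times \<open>d / (d + 1)\<close>, hence at most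
    \<open>b / 2 * p\<close>; the added 1 keeps it meaningful for \<open>d = 0\<close>.\<close>
  obtain C where C: "C > 0" "\<And>y. y \<ge> 0 \<Longrightarrow> bessel_series a y \<le> C * exp (1 / (2 * (d + 1)) * y)"
    using bessel_series_bound[of a "1 / (2 * (d + 1))"] a d by auto
  \<comment> \<open>The first entry serves \<open>a \<le> 1\<close>, where the power does not
    increase on \<open>p \<ge> x\<close>; the second is the constant of \<open>powr_le_exp\<close>
    for the exponent \<open>a - 1\<close> and the rate \<open>b / 2\<close>.\<close>
  define K where "K = max (x powr (a - 1)) (((a - 1) / (b / 2)) powr (a - 1))"
  have K0: "K \<ge> 0" by (simp add: K_def le_max_iff_disj)
  have K: "p powr (a - 1) \<le> K * exp (b / 2 * p)" if "p \<ge> x" for p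
  proof (cases "a > 1")
    case True
    have "p powr (a - 1) \<le> ((a - 1) / (b / 2)) powr (a - 1) * exp (b / 2 * p)"
      using True b x that by (intro powr_le_exp) auto
    also have "\<dots> \<le> K * exp (b / 2 * p)" by (intro mult_right_mono) (auto simp: K_def)
    finally show ?thesis .
  next
    case False
    have "p powr (a - 1) \<le> x powr (a - 1)" using False x that by (intro powr_mono2') auto
    also have "\<dots> \<le> K * 1" by (simp add: K_def)
    also have "\<dots> \<le> K * exp (b / 2 * p)" using x b that K0 by (intro mult_left_mono) auto
    finally show ?thesis .
  qed
  have "nc_gamma_density a b d p \<le> b powr a * K * C" if p: "p \<ge> x" for p
  proof -
    have p0: "p > 0" using p x by simp
    have "1 / (2 * (d + 1)) * (d * b * p) = (b / 2 * p) * (d / (d + 1))"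
      by simp
    also have "\<dots> \<le> (b / 2 * p) * 1" using b p0 d by (intro mult_left_mono) auto
    finally have "bessel_series a (d * b * p) \<le> C * exp (b / 2 * p)"
      using C(2)[of "d * b * p"] C(1) b d p0 by (smt (verit) exp_le_cancel_iff mult_left_mono mult_nonneg_nonneg)
    moreover have "exp (- b * p - d) \<le> exp (- b * p)" using d by simp
    ultimately have "b powr a * p powr (a - 1) * exp (- b * p - d) * bessel_series a (d * b * p) \<le>
       b powr a * (K * exp (b / 2 * p)) * exp (- b * p) * (C * exp (b / 2 * p))"
      using K[OF p] a b d p0 C(1)
      by (intro mult_mono) (auto intro!: mult_nonneg_nonneg bessel_series_nonneg K0)
    also have "\<dots> = b powr a * K * C * exp (b / 2 * p + - b * p + b / 2 * p)"
      by (simp only: exp_add mult_ac)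
    also have "\<dots> = b powr a * K * C" by simp
    finally show ?thesis using p0 by (simp add: nc_gamma_density_def)
  qed
  moreover have "b powr a * K * C \<ge> 0" using C(1) K0 by auto
  ultimately show ?thesis by blast
qed

section \<open>Integrability of the convolution integrand, and its value on the two
  half-lines\<close>

lemma integrable_nc_gamma_density:
  assumes n: "n \<ge> 1" and b: "b > 0" and d: "d \<ge> 0"
  shows "integrable lborel (nc_gamma_density (real n / 2) b d)"
proof (rule integrableI_nonneg)
  interpret prob_space "nc_gamma_measure (real n / 2) b d"
    by (rule prob_space_nc_gamma_density) fact+
  show "(\<integral>\<^sup>+x. ennreal (nc_gamma_density (real n / 2) b d x) \<partial>lborel) < \<infinity>"
    using emeasure_space_1 n by (simp add: emeasure_density)
qed (use assms in \<open>auto simp: nc_gamma_density_nonneg\<close>)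

text \<open>Only the values at positive \<open>x\<close> matter: for positive rates and
  \<open>0 < a \<le> 1/2\<close> the integral diverges at \<open>x = 0\<close>, and the value there
  is a default.\<close>

definition gamma_difference_density :: "real \<Rightarrow> real \<Rightarrow> real \<Rightarrow> real \<Rightarrow> real \<Rightarrow> real \<Rightarrow> real" where
  "gamma_difference_density a b d b' d' x =
     (\<integral>q. nc_gamma_density a b d (x + q) * nc_gamma_density a b' d' q \<partial>lborel)"

text \<open>For \<open>x > 0\<close> the first factor is evaluated beyond \<open>x\<close> wherever
  the second is nonzero. It is bounded there, so the integrable second factor dominates; the
  singularities of the two densities never meet.\<close>

lemma integrable_gamma_difference:
  assumes n: "n \<ge> 1" and b: "b > 0" "b' > 0" and d: "d \<ge> 0" "d' \<ge> 0" and x: "x > 0"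
  shows "integrable lborel (\<lambda>q. nc_gamma_density (real n / 2) b d (x + q) * nc_gamma_density (real n / 2) b' d' q)"
proof -
  define a where "a = real n / 2"
  have a: "a > 0" using n by (simp add: a_def)
  obtain C where C: "C \<ge> 0" "\<And>p. p \<ge> x \<Longrightarrow> nc_gamma_density a b d p \<le> C"
    using nc_gamma_density_bounded[of a b d x] a b d x by blast
  have "integrable lborel (\<lambda>q. nc_gamma_density a b d (x + q) * nc_gamma_density a b' d' q)"
  proof (rule Bochner_Integration.integrable_bound)
    show "integrable lborel (\<lambda>q. C * nc_gamma_density a b' d' q)"
      unfolding a_def using n b d by (intro integrable_mult_right integrable_nc_gamma_density)
    show "AE q in lborel. norm (nc_gamma_density a b d (x + q) * nc_gamma_density a b' d' q) \<le>
        norm (C * nc_gamma_density a b' d' q)"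
    proof (intro AE_I2)
      fix q
      show "norm (nc_gamma_density a b d (x + q) * nc_gamma_density a b' d' q) \<le>
        norm (C * nc_gamma_density a b' d' q)"
      proof (cases "q > 0")
        case True
        then show ?thesis
          using C a b d nc_gamma_density_nonneg[of a b d "x + q"] nc_gamma_density_nonneg[of a b' d' q]
          by (auto simp: abs_mult intro!: mult_right_mono)
      qed (simp add: nc_gamma_density_def)
    qed
  qed (use a in measurable)
  then show ?thesis by (simp add: a_def)
qed

lemma gamma_difference_density_nonneg:
  assumes "a > 0" "b > 0" "b' > 0" "d \<ge> 0" "d' \<ge> 0"
  shows "0 \<le> gamma_difference_density a b d b' d' x"
  unfolding gamma_difference_density_def using assms
  by (intro integral_nonneg_AE AE_I2 mult_nonneg_nonneg nc_gamma_density_nonneg)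

lemma nn_integral_gamma_difference_pos:
  assumes n: "n \<ge> 1" and b: "b > 0" "b' > 0" and d: "d \<ge> 0" "d' \<ge> 0" and x: "x > 0"
  shows "(\<integral>\<^sup>+y. ennreal (nc_gamma_density (real n / 2) b d (x - y)) * ennreal (nc_gamma_density (real n / 2) b' d' (- y)) \<partial>lborel)
    = ennreal (gamma_difference_density (real n / 2) b d b' d' x)"
proof -
  have "(\<integral>\<^sup>+y. ennreal (nc_gamma_density (real n / 2) b d (x - y)) * ennreal (nc_gamma_density (real n / 2) b' d' (- y)) \<partial>lborel)
     = (\<integral>\<^sup>+q. ennreal (nc_gamma_density (real n / 2) b d (x + q) * nc_gamma_density (real n / 2) b' d' q) \<partial>lborel)"
    using n b d by (subst nn_integral_real_affine[where c="-1" and t=0])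
      (auto simp: ennreal_mult nc_gamma_density_nonneg)
  also have "\<dots> = ennreal (gamma_difference_density (real n / 2) b d b' d' x)"
    unfolding gamma_difference_density_def using assms
    by (intro nn_integral_eq_integral integrable_gamma_difference AE_I2 mult_nonneg_nonneg nc_gamma_density_nonneg) auto
  finally show ?thesis .
qed

text \<open>Shifting \<open>y\<close> by \<open>x\<close> exchanges the roles of the two densities:
  a negative difference is a positive one with its terms interchanged. This is the source of the
  rule for negative arguments.\<close>

lemma nn_integral_gamma_difference_neg:
  assumes n: "n \<ge> 1" and b: "b > 0" "b' > 0" and d: "d \<ge> 0" "d' \<ge> 0" and x: "x < 0"
  shows "(\<integral>\<^sup>+y. ennreal (nc_gamma_density (real n / 2) b d (x - y)) * ennreal (nc_gamma_density (real n / 2) b' d' (- y)) \<partial>lborel)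
    = ennreal (gamma_difference_density (real n / 2) b' d' b d (- x))"
proof -
  have "(\<integral>\<^sup>+y. ennreal (nc_gamma_density (real n / 2) b d (x - y)) * ennreal (nc_gamma_density (real n / 2) b' d' (- y)) \<partial>lborel)
     = (\<integral>\<^sup>+y. ennreal (nc_gamma_density (real n / 2) b' d' (- x - y)) * ennreal (nc_gamma_density (real n / 2) b d (- y)) \<partial>lborel)"
    using n by (subst nn_integral_real_affine[where c=1 and t=x]) (auto simp: mult.commute)
  also have "\<dots> = ennreal (gamma_difference_density (real n / 2) b' d' b d (- x))"
    using assms by (intro nn_integral_gamma_difference_pos) auto
  finally show ?thesis .
qed

text \<open>The substitution \<open>q = x * t\<close> reduces each explicit formula to a pointwise
  factorization of the integrand. Since \<open>K \<noteq> 0\<close>, integrability of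
  \<open>g\<close> can be read off from that of the product; this is why the prefactors
  \<open>D1\<close>, \<open>D2\<close> and \<open>D3\<close> are shown to be nonzero.\<close>

lemma gamma_difference_density_scaled:
  assumes n: "n \<ge> 1" and b: "b > 0" "b' > 0" and d: "d \<ge> 0" "d' \<ge> 0" and x: "x > 0"
    and K: "K \<noteq> 0"
    and eq: "\<And>t. t > 0 \<Longrightarrow> x * (nc_gamma_density (real n / 2) b d (x * (1 + t)) * nc_gamma_density (real n / 2) b' d' (x * t)) = K * g t"
  shows "set_integrable lborel {0<..} g \<and>
    gamma_difference_density (real n / 2) b d b' d' x = K * (LBINT t:{0<..}. g t)"
proof -
  define H where "H q = nc_gamma_density (real n / 2) b d (x + q) * nc_gamma_density (real n / 2) b' d' q" for q
  have H: "integrable lborel H"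
    unfolding H_def[abs_def] using assms by (intro integrable_gamma_difference)
  have g: "indicator {0<..} t *\<^sub>R g t = x / K * H (0 + x * t)" for t
  proof (cases "t > 0")
    case True
    then show ?thesis using eq[of t] K by (simp add: H_def field_simps)
  next
    case False
    then have "\<not> x * t > 0" using x by (simp add: zero_less_mult_iff)
    then show ?thesis using False by (simp add: H_def nc_gamma_density_def)
  qed
  have "set_integrable lborel {0<..} g"
    unfolding set_integrable_def g using x
    by (intro integrable_mult_right lborel_integrable_real_affine H) auto
  moreover have "gamma_difference_density (real n / 2) b d b' d' x = x * (\<integral>t. H (0 + x * t) \<partial>lborel)"
    unfolding gamma_difference_density_def H_def[symmetric]
    using x by (subst lborel_integral_real_affine[where c=x and t=0]) auto
  moreover have "(LBINT t:{0<..}. g t) = x / K * (\<integral>t. H (0 + x * t) \<partial>lborel)"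
    unfolding set_lebesgue_integral_def g by simp
  ultimately show ?thesis using K by simp
qed

text \<open>The Bessel argument \<open>z\<close> is such that \<open>(z / 2)\<^sup>2\<close> is the
  argument of the entire function, so the two differ only by
  \<open>(z / 2) powr (real n / 2 - 1)\<close>. That power is absorbed in the quotient with exponent
  \<open>(real n - 2) / 4\<close>, where \<open>B\<close> stands in the denominator.\<close>

lemma nc_gamma_density_bessel_I:
  assumes c: "c > 0" and R: "R > 0" and B: "B > 0" and n: "n \<ge> 1" and p: "p > 0"
  shows "nc_gamma_density (real n / 2) (1 / (c * R)) (real n * (B\<^sup>2 / (4 * R))) p =
    1 / (c * R) * (p / c / (real n / 4 * B\<^sup>2)) powr ((real n - 2) / 4) *
    exp (- (p / (c * R)) - real n * (B\<^sup>2 / (4 * R))) *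
    bessel_I (real n / 2 - 1) (B * (sqrt (real n * p) / (R * sqrt c)))"
proof -
  define z where "z = B * (sqrt (real n * p) / (R * sqrt c))"
  define s where "s = (real n - 2) / 4"
  define b where "b = 1 / (c * R)"
  define y where "y = (z / 2)\<^sup>2"
  have z: "z > 0" using assms by (simp add: z_def)
  have b: "b > 0" using c R by (simp add: b_def)
  have "z\<^sup>2 = B\<^sup>2 * (real n * p / (R\<^sup>2 * c))"
    using assms by (simp add: z_def power_mult_distrib power_divide)
  then have y: "y = real n * (B\<^sup>2 / (4 * R)) * b * p"
    by (simp add: y_def power_divide b_def power2_eq_square mult_ac)
  have y0: "y > 0" using z by (simp add: y_def)
  \<comment> \<open>Written over \<open>y\<close>, the \<open>s\<close>-th power of the quotient
    cancels against \<open>(z / 2) powr (2 * s) = y powr s\<close>.\<close>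
  have q: "p / c / (real n / 4 * B\<^sup>2) = (b * p)\<^sup>2 / y"
    unfolding y b_def using assms by (simp add: power2_eq_square field_simps)
  have half: "(z / 2) powr (2 * s) = y powr s"
    using z by (simp add: y_def powr_powr[symmetric])
  have "((b * p)\<^sup>2 / y) powr s * (z / 2) powr (2 * s) = (b * p) powr (2 * s)"
    unfolding half using b p y0 by (simp add: powr_divide powr_powr[symmetric])
  also have "b * \<dots> = b powr (1 + 2 * s) * p powr (2 * s)"
    using b p by (simp add: powr_mult powr_add)
  finally have "b * (((b * p)\<^sup>2 / y) powr s * (z / 2) powr (2 * s)) = b powr (1 + 2 * s) * p powr (2 * s)" .
  moreover have "2 * s = real n / 2 - 1" "1 + 2 * s = real n / 2" by (simp_all add: s_def field_simps)
  ultimately have pw: "b powr (real n / 2) * p powr (real n / 2 - 1) =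
      b * ((p / c / (real n / 4 * B\<^sup>2)) powr s * (z / 2) powr (real n / 2 - 1))"
    by (simp only: q)
  have I: "bessel_I (real n / 2 - 1) z = (z / 2) powr (real n / 2 - 1) * bessel_series (real n / 2) y"
    using bessel_I_eq_bessel_series[of "real n / 2 - 1" z] z n by (simp add: y_def)
  have e: "- b * p - real n * (B\<^sup>2 / (4 * R)) = - (p / (c * R)) - real n * (B\<^sup>2 / (4 * R))"
    by (simp add: b_def)
  have "nc_gamma_density (real n / 2) b (real n * (B\<^sup>2 / (4 * R))) p =
     (b powr (real n / 2) * p powr (real n / 2 - 1)) * exp (- (p / (c * R)) - real n * (B\<^sup>2 / (4 * R))) *
     bessel_series (real n / 2) y"
    unfolding nc_gamma_density_def e y[symmetric] using p by simp
  also have "\<dots> = b * (p / c / (real n / 4 * B\<^sup>2)) powr s * exp (- (p / (c * R)) - real n * (B\<^sup>2 / (4 * R))) *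
     bessel_I (real n / 2 - 1) z"
    unfolding pw I by (simp only: mult_ac)
  finally show ?thesis by (simp only: b_def z_def s_def)
qed

lemma nc_gamma_density_central:
  assumes "p > 0"
  shows "nc_gamma_density a b 0 p = b powr a * p powr (a - 1) * exp (- b * p) / Gamma a"
  using assms by (simp add: nc_gamma_density_def bessel_series_0)

text \<open>\<open>\<alpha>\<close> and \<open>\<beta>\<close> are the normalized means \<open>\<mu>\<^sub>X / \<sigma>\<^sub>X\<close> and \<open>\<mu>\<^sub>Y / \<sigma>\<^sub>Y\<close>, and \<open>c = \<sigma>\<^sub>X * \<sigma>\<^sub>Y\<close>.\<close>

definition product_sum_density :: "nat \<Rightarrow> real \<Rightarrow> real \<Rightarrow> real \<Rightarrow> real \<Rightarrow> real \<Rightarrow> real" where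
  "product_sum_density n \<alpha> \<beta> c r x =
     gamma_difference_density (real n / 2)
       (1 / (c * (1 + r))) (real n * ((\<alpha> + \<beta>)\<^sup>2 / (4 * (1 + r))))
       (1 / (c * (1 - r))) (real n * ((\<alpha> - \<beta>)\<^sup>2 / (4 * (1 - r)))) x"

section \<open>The explicit formulas\<close>

text \<open>One law is central and contributes a plain power. Leaving \<open>R\<close>,
  \<open>R'\<close>, \<open>t\<close> and \<open>t'\<close> free makes the cases of equal and of
  opposite normalized means two instances, with \<open>1 + r\<close> and \<open>1 - r\<close>
  exchanged together with the arguments.\<close>

lemma nc_gamma_density_one_sided:
  assumes c: "c > 0" and R: "R > 0" "R' > 0" and m: "m > 0" and x: "x > 0"
    and t: "t > 0" "t' > 0" and n: "n \<ge> 1"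
  shows "x * (nc_gamma_density (real n / 2) (1 / (c * R)) (real n * ((2 * m)\<^sup>2 / (4 * R))) (x * t) *
      nc_gamma_density (real n / 2) (1 / (c * R')) 0 (x * t')) =
    real n powr ((2 - real n) / 4) / (c * R' powr (real n / 2) * R * Gamma (real n / 2)) *
    m powr (1 - real n / 2) * (x / c) powr ((3 * real n - 2) / 4) *
    ((t'\<^sup>2 * t) powr ((real n - 2) / 4) *
     exp (- (x * t / (c * R)) - real n * m\<^sup>2 / R - x * t' / (c * R')) *
     bessel_I (real n / 2 - 1) (2 * m * (sqrt (real n * (x * t)) / (R * sqrt c))))"
proof -
  define s where "s = (real n - 2) / 4"
  define u where "u = x / c"
  define I where "I = bessel_I (real n / 2 - 1) (2 * m * (sqrt (real n * (x * t)) / (R * sqrt c)))"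
  define e1 where "e1 = - (x * t / (c * R)) - real n * ((2 * m)\<^sup>2 / (4 * R))"
  define e2 where "e2 = - (1 / (c * R')) * (x * t')"
  have u: "u > 0" using x c by (simp add: u_def)
  \<comment> \<open>All exponents become affine in \<open>s\<close>. That of \<open>x / c\<close> is
    split into \<open>1 + 2 * s\<close>, from the central factor and the Jacobian \<open>x\<close>,
    and \<open>s\<close>, from the noncentral factor.\<close>
  have h: "real n / 2 = 1 + 2 * s" "real n / 2 - 1 = 2 * s" "1 - real n / 2 = - (2 * s)"
    "(2 - real n) / 4 = - s" "(3 * real n - 2) / 4 = 1 + 2 * s + s" "(real n - 2) / 4 = s"
    by (simp_all add: s_def field_simps)
  have base: "x * t / c / (real n / 4 * (2 * m)\<^sup>2) = u * t / (real n * m\<^sup>2)"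
    by (simp add: u_def power2_eq_square)
  have G1: "nc_gamma_density (real n / 2) (1 / (c * R)) (real n * ((2 * m)\<^sup>2 / (4 * R))) (x * t) =
      1 / (c * R) * (u * t / (real n * m\<^sup>2)) powr s * exp e1 * I"
  proof -
    have "2 * m > 0" "x * t > 0" using m x t by auto
    from nc_gamma_density_bessel_I[OF c R(1) this(1) n this(2)]
    show ?thesis unfolding base h(6) I_def e1_def .
  qed
  have G2: "nc_gamma_density (real n / 2) (1 / (c * R')) 0 (x * t') =
      (1 / (c * R')) powr (1 + 2 * s) * (x * t') powr (2 * s) * exp e2 / Gamma (real n / 2)"
  proof -
    have "x * t' > 0" using x t by simp
    then show ?thesis
      unfolding h(1)[symmetric] unfolding h(2)[symmetric] e2_def by (rule nc_gamma_density_central)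
  qed
  have p1: "(u * t / (real n * m\<^sup>2)) powr s = u powr s * t powr s * real n powr (- s) * m powr (- (2 * s))"
  proof -
    have "(u * t / (real n * m\<^sup>2)) powr s = u powr s * t powr s / (real n powr s * (m powr 2) powr s)"
      using u t m by (simp add: powr_divide powr_mult)
    then show ?thesis unfolding powr_powr powr_minus by (simp only: divide_inverse inverse_mult_distrib mult_ac)
  qed
  have p2: "x * ((1 / (c * R')) powr (1 + 2 * s) * (x * t') powr (2 * s)) = u powr (1 + 2 * s) / R' powr (1 + 2 * s) * t' powr (2 * s)"
  proof -
    have "x * (x * t') powr (2 * s) = x powr (1 + 2 * s) * t' powr (2 * s)"
      using x t by (simp add: powr_mult powr_add)
    then have "x * ((1 / (c * R')) powr (1 + 2 * s) * (x * t') powr (2 * s)) =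
        ((1 / (c * R')) powr (1 + 2 * s) * x powr (1 + 2 * s)) * t' powr (2 * s)"
      by (simp only: mult.left_commute[of x] mult.assoc)
    also have "(1 / (c * R')) powr (1 + 2 * s) * x powr (1 + 2 * s) = (u / R') powr (1 + 2 * s)"
      by (simp add: powr_mult[symmetric] u_def)
    also have "\<dots> = u powr (1 + 2 * s) / R' powr (1 + 2 * s)"
      using u R by (simp add: powr_divide)
    finally show ?thesis .
  qed
  have p3: "(t'\<^sup>2 * t) powr s = t' powr (2 * s) * t powr s"
  proof -
    have "(t'\<^sup>2 * t) powr s = (t' powr 2) powr s * t powr s" using t by (simp add: powr_mult)
    then show ?thesis unfolding powr_powr .
  qed
  have p4: "u powr (1 + 2 * s + s) = u powr (1 + 2 * s) * u powr s" by (rule powr_add)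
  have e: "exp (- (x * t / (c * R)) - real n * m\<^sup>2 / R - x * t' / (c * R')) = exp e1 * exp e2"
    unfolding exp_add[symmetric] by (simp add: e1_def e2_def power2_eq_square)
  have "x * (nc_gamma_density (real n / 2) (1 / (c * R)) (real n * ((2 * m)\<^sup>2 / (4 * R))) (x * t) *
      nc_gamma_density (real n / 2) (1 / (c * R')) 0 (x * t')) =
    1 / (c * R) * (u * t / (real n * m\<^sup>2)) powr s *
    (x * ((1 / (c * R')) powr (1 + 2 * s) * (x * t') powr (2 * s))) * exp e1 * exp e2 * I / Gamma (real n / 2)"
    unfolding G1 G2 by (simp only: mult_ac times_divide_eq_right)
  also have "\<dots> = real n powr (- s) / (c * R' powr (1 + 2 * s) * R * Gamma (real n / 2)) *
    m powr (- (2 * s)) * (u powr (1 + 2 * s) * u powr s) * (t' powr (2 * s) * t powr s * (exp e1 * exp e2) * I)"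
    unfolding p1 p2 by (simp only: divide_inverse inverse_mult_distrib mult_1_left mult_ac)
  finally show ?thesis
    unfolding e I_def[symmetric] u_def[symmetric] h(3-6) p3 p4
    by (simp only: h(1)[symmetric])
qed

text \<open>Partial fractions separate the part of the two decay exponents that is free of
  \<open>t\<close>, which goes to the prefactor, from the part that stays in the integrand.\<close>

lemma exponent_split:
  fixes c r x t :: real
  assumes "c > 0" "-1 < r" "r < 1"
  shows "x * (1 + t) / (c * (1 + r)) + x * t / (c * (1 - r)) = x / (c * (1 + r)) + 2 * x * t / (c * (1 - r\<^sup>2))"
proof -
  have "1 - r\<^sup>2 = (1 + r) * (1 - r)" by (simp add: power2_eq_square algebra_simps)
  moreover have "1 + r \<noteq> 0" "1 - r \<noteq> 0" using assms by auto
  ultimately show ?thesis using assms by (simp add: divide_simps) (simp add: algebra_simps)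
qed

text \<open>Both sides are half the squared Mahalanobis norm of the normalized means, diagonalized
  by their sum and difference; hence the quadratic form in \<open>D1\<close>.\<close>

lemma noncentrality_split:
  fixes \<alpha> \<beta> r :: real
  assumes "-1 < r" "r < 1"
  shows "(\<alpha> + \<beta>)\<^sup>2 / (4 * (1 + r)) + (\<alpha> - \<beta>)\<^sup>2 / (4 * (1 - r)) =
    (\<alpha>\<^sup>2 + \<beta>\<^sup>2 - 2 * r * \<alpha> * \<beta>) / (2 * (1 - r\<^sup>2))"
proof -
  have "1 - r\<^sup>2 = (1 + r) * (1 - r)" by (simp add: power2_eq_square algebra_simps)
  moreover have "1 + r \<noteq> 0" "1 - r \<noteq> 0" using assms by auto
  ultimately show ?thesis using assms by (simp add: divide_simps) (simp add: algebra_simps power2_eq_square)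
qed

text \<open>Different absolute values mean that neither the sum nor the difference of the normalized
  means vanishes, so both densities have the Bessel form.\<close>

lemma value1_product_sum_density:
  assumes sX: "sX > 0" and sY: "sY > 0" and r: "-1 < r" "r < 1" and n: "n \<ge> 1" and x: "x > 0"
    and ne: "\<bar>mX\<bar> / sX \<noteq> \<bar>mY\<bar> / sY"
  shows "value1 n mX mY sX sY r x (product_sum_density n (mX / sX) (mY / sY) (sX * sY) r x)"
proof -
  define \<alpha> \<beta> where "\<alpha> = mX / sX" and "\<beta> = mY / sY"
  define c where "c = sX * sY"
  define A B where "A = \<bar>\<alpha> - \<beta>\<bar>" and "B = \<bar>\<alpha> + \<beta>\<bar>"
  define s where "s = (real n - 2) / 4"
  define u where "u = x / c"
  have c: "c > 0" and u: "u > 0" using sX sY x by (auto simp: c_def u_def)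
  have "\<bar>\<alpha>\<bar> \<noteq> \<bar>\<beta>\<bar>" using ne sX sY by (simp add: \<alpha>_def \<beta>_def)
  then have A: "A > 0" and B: "B > 0" by (auto simp: A_def B_def)
  have r1: "1 + r > 0" "1 - r > 0" using r by auto
  have r2: "1 - r\<^sup>2 = (1 + r) * (1 - r)" by (simp add: power2_eq_square algebra_simps)
  have sq: "mX\<^sup>2 / sX\<^sup>2 = \<alpha>\<^sup>2" "mY\<^sup>2 / sY\<^sup>2 = \<beta>\<^sup>2" "2 * r * mX * mY / c = 2 * r * \<alpha> * \<beta>"
    by (simp_all add: c_def \<alpha>_def \<beta>_def power_divide)
  have M: "\<bar>\<alpha>\<^sup>2 - \<beta>\<^sup>2\<bar> = A * B"
    by (simp add: A_def B_def abs_mult[symmetric] power2_eq_square algebra_simps)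
  have h: "1 - real n / 2 = - (2 * s)" "real n / 2 = 1 + 2 * s"
    by (simp_all add: s_def field_simps)
  define E0 where "E0 = - (real n / (2 * (1 - r\<^sup>2))) * (\<alpha>\<^sup>2 + \<beta>\<^sup>2 - 2 * r * \<alpha> * \<beta>) - x / (c * (1 + r))"
  have D: "D1 n mX mY sX sY r x =
     1 / (c * (1 - r\<^sup>2)) * (real n / 4) powr (- (2 * s)) * (A * B) powr (- (2 * s)) * (u * u powr (2 * s)) * exp E0"
    unfolding D1_def sq M c_def[symmetric] u_def[symmetric] E0_def[symmetric] h(1)
    unfolding h(2) using u by (simp only: powr_add powr_one_gt_zero_iff[THEN iffD2])
  have "D1 n mX mY sX sY r x \<noteq> 0"
    unfolding D using c u A B n r2 r1 by simp
  moreover have "x * (nc_gamma_density (real n / 2) (1 / (c * (1 + r))) (real n * ((\<alpha> + \<beta>)\<^sup>2 / (4 * (1 + r)))) (x * (1 + t)) *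
      nc_gamma_density (real n / 2) (1 / (c * (1 - r))) (real n * ((\<alpha> - \<beta>)\<^sup>2 / (4 * (1 - r)))) (x * t)) =
    D1 n mX mY sX sY r x * integrand1 n mX mY sX sY r x t" if t: "t > 0" for t
  proof -
    define I1 where "I1 = bessel_I (real n / 2 - 1) (B * (sqrt (real n * (x * (1 + t))) / ((1 + r) * sqrt c)))"
    define I2 where "I2 = bessel_I (real n / 2 - 1) (A * (sqrt (real n * (x * t)) / ((1 - r) * sqrt c)))"
    define e1 where "e1 = - (x * (1 + t) / (c * (1 + r))) - real n * ((\<alpha> + \<beta>)\<^sup>2 / (4 * (1 + r)))"
    define e2 where "e2 = - (x * t / (c * (1 - r))) - real n * ((\<alpha> - \<beta>)\<^sup>2 / (4 * (1 - r)))"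
    define e3 where "e3 = - (2 * x * t) / (c * (1 - r\<^sup>2))"
    have AB2: "A\<^sup>2 = (\<alpha> - \<beta>)\<^sup>2" "B\<^sup>2 = (\<alpha> + \<beta>)\<^sup>2" by (simp_all add: A_def B_def)
    have G1: "nc_gamma_density (real n / 2) (1 / (c * (1 + r))) (real n * ((\<alpha> + \<beta>)\<^sup>2 / (4 * (1 + r)))) (x * (1 + t)) =
      1 / (c * (1 + r)) * (x * (1 + t) / c / (real n / 4 * B\<^sup>2)) powr s * exp e1 * I1"
      using nc_gamma_density_bessel_I[of c "1 + r" B n "x * (1 + t)"] c r1 B n x t
      unfolding AB2 by (simp add: I1_def e1_def s_def)
    have G2: "nc_gamma_density (real n / 2) (1 / (c * (1 - r))) (real n * ((\<alpha> - \<beta>)\<^sup>2 / (4 * (1 - r)))) (x * t) =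
      1 / (c * (1 - r)) * (x * t / c / (real n / 4 * A\<^sup>2)) powr s * exp e2 * I2"
      using nc_gamma_density_bessel_I[of c "1 - r" A n "x * t"] c r1 A n x t
      unfolding AB2 by (simp add: I2_def e2_def s_def)
    have int: "integrand1 n mX mY sX sY r x t = (t * (t + 1)) powr s * exp e3 * I2 * I1"
      unfolding integrand1_def I1_def I2_def e3_def s_def A_def B_def \<alpha>_def \<beta>_def c_def
      by (simp only: mult.assoc)
    have ee: "exp e1 * exp e2 = exp E0 * exp e3"
    proof -
      have "e1 + e2 = E0 + e3"
        using exponent_split[OF c r, of x t] arg_cong[OF noncentrality_split[OF r, of \<alpha> \<beta>], of "\<lambda>z. real n * z"]
        unfolding e1_def e2_def E0_def e3_def by (simp add: distrib_left)
      then show ?thesis by (simp only: exp_add[symmetric])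
    qed
    have pp: "(x * (1 + t) / c / (real n / 4 * B\<^sup>2)) powr s * (x * t / c / (real n / 4 * A\<^sup>2)) powr s =
       (real n / 4) powr (- (2 * s)) * (A * B) powr (- (2 * s)) * u powr (2 * s) * (t * (t + 1)) powr s"
    proof -
      \<comment> \<open>The two quotients multiply to a square times \<open>t * (t + 1)\<close>; the
        square doubles the exponents of \<open>real n / 4\<close>, \<open>A * B\<close> and
        \<open>u\<close>.\<close>
      have "(x * (1 + t) / c / (real n / 4 * B\<^sup>2)) * (x * t / c / (real n / 4 * A\<^sup>2)) =
          (u / (real n / 4 * (A * B)))\<^sup>2 * (t * (t + 1))"
        by (simp add: u_def power2_eq_square mult_ac add_ac)
      then have "(x * (1 + t) / c / (real n / 4 * B\<^sup>2)) powr s * (x * t / c / (real n / 4 * A\<^sup>2)) powr s =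
          ((u / (real n / 4 * (A * B))) powr 2) powr s * (t * (t + 1)) powr s"
        using u n A B by (simp only: powr_mult[symmetric]) simp
      also have "((u / (real n / 4 * (A * B))) powr 2) powr s = u powr (2 * s) / ((real n / 4) powr (2 * s) * (A * B) powr (2 * s))"
        unfolding powr_powr using u n A B by (simp only: powr_divide powr_mult)
      finally show ?thesis unfolding powr_minus by (simp only: divide_inverse inverse_mult_distrib mult_ac)
    qed
    \<comment> \<open>The Jacobian \<open>x\<close> and the two rates give the leading fraction of
      \<open>D1\<close> and one factor \<open>u\<close>, which completes
      \<open>u powr (2 * s)\<close> to the exponent \<open>real n / 2\<close>.\<close>
    have xx: "x * (1 / (c * (1 + r))) * (1 / (c * (1 - r))) = 1 / (c * (1 - r\<^sup>2)) * u"
      unfolding r2 u_def by simp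
    have "x * (nc_gamma_density (real n / 2) (1 / (c * (1 + r))) (real n * ((\<alpha> + \<beta>)\<^sup>2 / (4 * (1 + r)))) (x * (1 + t)) *
      nc_gamma_density (real n / 2) (1 / (c * (1 - r))) (real n * ((\<alpha> - \<beta>)\<^sup>2 / (4 * (1 - r)))) (x * t)) =
      (x * (1 / (c * (1 + r))) * (1 / (c * (1 - r)))) *
      ((x * (1 + t) / c / (real n / 4 * B\<^sup>2)) powr s * (x * t / c / (real n / 4 * A\<^sup>2)) powr s) *
      (exp e1 * exp e2) * (I1 * I2)"
      unfolding G1 G2 by (simp only: mult_ac)
    also have "\<dots> = D1 n mX mY sX sY r x * integrand1 n mX mY sX sY r x t"
      unfolding xx pp ee D int by (simp only: mult_ac)
    finally show ?thesis .
  qed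
  ultimately show ?thesis
    unfolding value1_def formula1_def product_sum_density_def \<alpha>_def[symmetric] \<beta>_def[symmetric] c_def[symmetric]
    using c r1 n x by (intro gamma_difference_density_scaled) auto
qed

text \<open>With equal normalized means the difference vanishes, so the subtracted variable is
  central and only the other one keeps a Bessel function.\<close>

lemma formula2_product_sum_density:
  assumes sX: "sX > 0" and sY: "sY > 0" and r: "-1 < r" "r < 1" and n: "n \<ge> 1" and x: "x > 0"
    and m: "mX \<noteq> 0"
  shows "set_integrable lborel {0<..} (integrand2 n mX sX sY r x) \<and>
    product_sum_density n (mX / sX) (mX / sX) (sX * sY) r x = formula2 n mX sX sY r x"
proof -
  define c where "c = sX * sY"
  define \<mu> where "\<mu> = \<bar>mX\<bar> / sX"
  have c: "c > 0" and \<mu>: "\<mu> > 0" using sX sY m by (auto simp: c_def \<mu>_def)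
  have r1: "1 + r > 0" "1 - r > 0" using r by auto
  have sq: "(mX / sX + mX / sX)\<^sup>2 = (2 * \<mu>)\<^sup>2" "real n * mX\<^sup>2 / (sX\<^sup>2 * (1 + r)) = real n * \<mu>\<^sup>2 / (1 + r)"
    by (simp_all add: \<mu>_def power_mult_distrib power_divide flip: mult_2)
  have "Gamma (real n / 2) > 0" using n by (intro Gamma_real_pos) simp
  then have "Gamma (real n / 2) \<noteq> 0" by simp
  then have "D2 n mX sX sY r x \<noteq> 0"
    unfolding D2_def using c r1 n x m sX sY by auto
  moreover have "x * (nc_gamma_density (real n / 2) (1 / (c * (1 + r))) (real n * ((2 * \<mu>)\<^sup>2 / (4 * (1 + r)))) (x * (1 + t)) *
      nc_gamma_density (real n / 2) (1 / (c * (1 - r))) 0 (x * t)) =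
    D2 n mX sX sY r x * integrand2 n mX sX sY r x t" if t: "t > 0" for t
  proof -
    have e: "exp (- (x * (1 + t) / (c * (1 + r))) - real n * \<mu>\<^sup>2 / (1 + r) - x * t / (c * (1 - r))) =
       exp (- (real n * \<mu>\<^sup>2 / (1 + r)) - x / (c * (1 + r))) * exp (- (2 * x * t) / (c * (1 - r\<^sup>2)))"
      using exponent_split[OF c r, of x t] unfolding exp_add[symmetric] by (simp add: algebra_simps)
    have "2 * \<bar>mX\<bar> / sX = 2 * \<mu>" by (simp add: \<mu>_def)
    then show ?thesis
      using nc_gamma_density_one_sided[OF c r1 \<mu> x, of "1 + t" t n] t n
      unfolding e D2_def integrand2_def minus_divide_left[symmetric] sq \<mu>_def[symmetric] c_def[symmetric]
      by (simp only: mult_ac add_ac)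
  qed
  ultimately have "set_integrable lborel {0<..} (integrand2 n mX sX sY r x) \<and>
      gamma_difference_density (real n / 2) (1 / (c * (1 + r))) (real n * ((2 * \<mu>)\<^sup>2 / (4 * (1 + r)))) (1 / (c * (1 - r))) 0 x =
      D2 n mX sX sY r x * (LBINT t:{0<..}. integrand2 n mX sX sY r x t)"
    using c r1 n x by (intro gamma_difference_density_scaled) auto
  then show ?thesis
    unfolding formula2_def product_sum_density_def c_def[symmetric] sq by simp
qed

lemma formula3_product_sum_density:
  assumes sX: "sX > 0" and sY: "sY > 0" and r: "-1 < r" "r < 1" and n: "n \<ge> 1" and x: "x > 0"
    and m: "mX \<noteq> 0"
  shows "set_integrable lborel {0<..} (integrand3 n mX sX sY r x) \<and>
    product_sum_density n (mX / sX) (- (mX / sX)) (sX * sY) r x = formula3 n mX sX sY r x"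
proof -
  define c where "c = sX * sY"
  define \<mu> where "\<mu> = \<bar>mX\<bar> / sX"
  have c: "c > 0" and \<mu>: "\<mu> > 0" using sX sY m by (auto simp: c_def \<mu>_def)
  have r1: "1 + r > 0" "1 - r > 0" using r by auto
  have sq: "(mX / sX - - (mX / sX))\<^sup>2 = (2 * \<mu>)\<^sup>2" "real n * mX\<^sup>2 / (sX\<^sup>2 * (1 - r)) = real n * \<mu>\<^sup>2 / (1 - r)"
    by (simp_all add: \<mu>_def power_mult_distrib power_divide flip: mult_2)
  have "Gamma (real n / 2) > 0" using n by (intro Gamma_real_pos) simp
  then have "Gamma (real n / 2) \<noteq> 0" by simp
  then have "D3 n mX sX sY r x \<noteq> 0"
    unfolding D3_def using c r1 n x m sX sY by auto
  moreover have "x * (nc_gamma_density (real n / 2) (1 / (c * (1 + r))) 0 (x * (1 + t)) *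
      nc_gamma_density (real n / 2) (1 / (c * (1 - r))) (real n * ((2 * \<mu>)\<^sup>2 / (4 * (1 - r)))) (x * t)) =
    D3 n mX sX sY r x * integrand3 n mX sX sY r x t" if t: "t > 0" for t
  proof -
    have e: "exp (- (x * t / (c * (1 - r))) - real n * \<mu>\<^sup>2 / (1 - r) - x * (1 + t) / (c * (1 + r))) =
       exp (- (real n * \<mu>\<^sup>2 / (1 - r)) - x / (c * (1 + r))) * exp (- (2 * x * t) / (c * (1 - r\<^sup>2)))"
      using exponent_split[OF c r, of x t] unfolding exp_add[symmetric] by (simp add: algebra_simps)
    have "2 * \<bar>mX\<bar> / sX = 2 * \<mu>" by (simp add: \<mu>_def)
    then show ?thesis
      \<comment> \<open>Here the sum of the normalized means vanishes and the subtracted variable is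
        the noncentral one, so the rates and the arguments are exchanged.\<close>
      using nc_gamma_density_one_sided[OF c r1(2,1) \<mu> x, of t "1 + t" n] t n
      unfolding e D3_def integrand3_def minus_divide_left[symmetric] sq \<mu>_def[symmetric] c_def[symmetric]
      by (simp only: mult_ac add_ac)
  qed
  ultimately have "set_integrable lborel {0<..} (integrand3 n mX sX sY r x) \<and>
      gamma_difference_density (real n / 2) (1 / (c * (1 + r))) 0 (1 / (c * (1 - r))) (real n * ((2 * \<mu>)\<^sup>2 / (4 * (1 - r)))) x =
      D3 n mX sX sY r x * (LBINT t:{0<..}. integrand3 n mX sX sY r x t)"
    using c r1 n x by (intro gamma_difference_density_scaled) auto
  then show ?thesis
    unfolding formula3_def product_sum_density_def c_def[symmetric] sq by simp
qed

section \<open>Vanishing means and the theorem\<close>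

text \<open>A dominating function uniform in small \<open>d\<close>: the series increases with
  \<open>d\<close>, \<open>exp (- d)\<close> is at most 1, and \<open>exp 1\<close> undoes the
  factor \<open>exp (- 1)\<close> in the density with noncentrality 1.\<close>

lemma nc_gamma_density_le:
  assumes a: "a > 0" and b: "b > 0" and d: "0 \<le> d" "d \<le> 1"
  shows "nc_gamma_density a b d p \<le> exp 1 * nc_gamma_density a b 1 p"
proof (cases "p > 0")
  case True
  have "b powr a * p powr (a - 1) * exp (- b * p - d) * bessel_series a (d * b * p) \<le>
      b powr a * p powr (a - 1) * exp (- b * p) * bessel_series a (1 * b * p)"
    using assms True
    by (intro mult_mono bessel_series_mono mult_right_mono) (auto intro!: mult_nonneg_nonneg bessel_series_nonneg)
  also have "exp (- b * p) = exp 1 * exp (- b * p - 1)" by (simp add: exp_add[symmetric])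
  finally show ?thesis using True by (simp add: nc_gamma_density_def mult_ac)
qed (simp add: nc_gamma_density_def)

lemma tendsto_nc_gamma_density:
  assumes "a > 0" "(d \<longlongrightarrow> l) G"
  shows "((\<lambda>i. nc_gamma_density a b (d i) p) \<longlongrightarrow> nc_gamma_density a b l p) G"
  unfolding nc_gamma_density_def
  by (cases "p > 0") (auto intro!: tendsto_intros assms isCont_tendsto_compose[OF continuous_bessel_series])

text \<open>Dominated convergence along an arbitrary sequence tending to 0: on a tail both
  noncentralities are below 1, and the product of the densities with noncentrality 1 dominates up to
  a constant.\<close>

lemma tendsto_gamma_difference_density_0:
  assumes n: "n \<ge> 1" and b: "b > 0" "b' > 0" and x: "x > 0"
    and nonneg: "\<And>m::real. d m \<ge> 0" "\<And>m. d' m \<ge> 0"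
    and lim: "(d \<longlongrightarrow> 0) (at 0)" "(d' \<longlongrightarrow> 0) (at 0)"
  shows "((\<lambda>m. gamma_difference_density (real n / 2) b (d m) b' (d' m) x) \<longlongrightarrow>
    gamma_difference_density (real n / 2) b 0 b' 0 x) (at 0)"
  unfolding tendsto_at_iff_sequentially
proof (intro allI impI)
  fix X :: "nat \<Rightarrow> real"
  assume X: "\<forall>i. X i \<in> UNIV - {0}" "X \<longlonglongrightarrow> 0"
  define a where "a = real n / 2"
  have a: "a > 0" using n by (simp add: a_def)
  have dX: "(\<lambda>i. d (X i)) \<longlonglongrightarrow> 0" "(\<lambda>i. d' (X i)) \<longlonglongrightarrow> 0"
    using lim X unfolding tendsto_at_iff_sequentially o_def by auto
  have "\<forall>\<^sub>F i in sequentially. d (X i) < 1 \<and> d' (X i) < 1"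
    using order_tendstoD(2)[OF dX(1) zero_less_one] order_tendstoD(2)[OF dX(2) zero_less_one] by eventually_elim simp
  then obtain N where "\<forall>i\<ge>N. d (X i) < 1 \<and> d' (X i) < 1"
    by (auto simp: eventually_sequentially)
  then have N: "d (X (i + N)) < 1" "d' (X (i + N)) < 1" for i by auto
  have "(\<lambda>i. \<integral>q. nc_gamma_density a b (d (X (i + N))) (x + q) * nc_gamma_density a b' (d' (X (i + N))) q \<partial>lborel)
      \<longlonglongrightarrow> (\<integral>q. nc_gamma_density a b 0 (x + q) * nc_gamma_density a b' 0 q \<partial>lborel)"
  proof (rule integral_dominated_convergence)
    show "integrable lborel (\<lambda>q. exp 1 * exp 1 * (nc_gamma_density a b 1 (x + q) * nc_gamma_density a b' 1 q))"
      unfolding a_def using n b x by (intro integrable_mult_right integrable_gamma_difference) auto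
    show "AE q in lborel. (\<lambda>i. nc_gamma_density a b (d (X (i + N))) (x + q) * nc_gamma_density a b' (d' (X (i + N))) q)
        \<longlonglongrightarrow> nc_gamma_density a b 0 (x + q) * nc_gamma_density a b' 0 q"
      using dX a by (intro AE_I2 tendsto_mult tendsto_nc_gamma_density LIMSEQ_ignore_initial_segment) auto
    show "AE q in lborel. norm (nc_gamma_density a b (d (X (i + N))) (x + q) * nc_gamma_density a b' (d' (X (i + N))) q)
        \<le> exp 1 * exp 1 * (nc_gamma_density a b 1 (x + q) * nc_gamma_density a b' 1 q)" for i
    proof (intro AE_I2)
      fix q
      have "nc_gamma_density a b (d (X (i + N))) (x + q) * nc_gamma_density a b' (d' (X (i + N))) q \<le>
         (exp 1 * nc_gamma_density a b 1 (x + q)) * (exp 1 * nc_gamma_density a b' 1 q)"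
        using a b nonneg N[of i] by (intro mult_mono nc_gamma_density_le mult_nonneg_nonneg nc_gamma_density_nonneg) auto
      moreover have "nc_gamma_density a b (d (X (i + N))) (x + q) * nc_gamma_density a b' (d' (X (i + N))) q \<ge> 0"
        using a b nonneg by (intro mult_nonneg_nonneg nc_gamma_density_nonneg) auto
      ultimately show "norm (nc_gamma_density a b (d (X (i + N))) (x + q) * nc_gamma_density a b' (d' (X (i + N))) q)
        \<le> exp 1 * exp 1 * (nc_gamma_density a b 1 (x + q) * nc_gamma_density a b' 1 q)"
        by (simp add: mult_ac)
    qed
  qed (use a in measurable)
  then have "(\<lambda>i. gamma_difference_density a b (d (X i)) b' (d' (X i)) x) \<longlonglongrightarrow> gamma_difference_density a b 0 b' 0 x"
    unfolding gamma_difference_density_def by (rule LIMSEQ_offset)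
  then show "((\<lambda>m. gamma_difference_density (real n / 2) b (d m) b' (d' m) x) \<circ> X) \<longlonglongrightarrow>
      gamma_difference_density (real n / 2) b 0 b' 0 x"
    by (simp add: a_def o_def)
qed

lemma tendsto_product_sum_density_0:
  assumes c: "c > 0" and r: "-1 < r" "r < 1" and n: "n \<ge> 1" and x: "x > 0"
    and lim: "(\<alpha> \<longlongrightarrow> 0) (at (0::real))" "(\<beta> \<longlongrightarrow> 0) (at 0)"
  shows "((\<lambda>m. product_sum_density n (\<alpha> m) (\<beta> m) c r x) \<longlongrightarrow> product_sum_density n 0 0 c r x) (at 0)"
proof -
  have "((\<lambda>m. real n * ((\<alpha> m + \<beta> m)\<^sup>2 / (4 * (1 + r)))) \<longlongrightarrow> real n * ((0 + 0)\<^sup>2 / (4 * (1 + r)))) (at 0)"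
    "((\<lambda>m. real n * ((\<alpha> m - \<beta> m)\<^sup>2 / (4 * (1 - r)))) \<longlongrightarrow> real n * ((0 - 0)\<^sup>2 / (4 * (1 - r)))) (at 0)"
    using r by (intro tendsto_intros lim; simp)+
  then show ?thesis
    using tendsto_gamma_difference_density_0[OF n _ _ x,
        of "1 / (c * (1 + r))" "1 / (c * (1 - r))" "\<lambda>m. real n * ((\<alpha> m + \<beta> m)\<^sup>2 / (4 * (1 + r)))"
          "\<lambda>m. real n * ((\<alpha> m - \<beta> m)\<^sup>2 / (4 * (1 - r)))"] c r
    unfolding product_sum_density_def by simp
qed

text \<open>At \<open>mX = 0\<close> the formula is indeterminate, but for every
  \<open>m \<noteq> 0\<close> it equals the density with both normalized means
  \<open>m / sX\<close>, and this density is continuous at \<open>m = 0\<close>.\<close>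

lemma value2_product_sum_density:
  assumes sX: "sX > 0" and sY: "sY > 0" and r: "-1 < r" "r < 1" and n: "n \<ge> 1" and x: "x > 0"
    and eq: "mX / sX = mY / sY"
  shows "value2 n mX sX sY r x (product_sum_density n (mX / sX) (mY / sY) (sX * sY) r x)"
proof (cases "mX = 0")
  case True
  have "((\<lambda>m. product_sum_density n (m / sX) (m / sX) (sX * sY) r x) \<longlongrightarrow>
      product_sum_density n 0 0 (sX * sY) r x) (at 0)"
    using assms by (intro tendsto_product_sum_density_0 tendsto_divide_zero tendsto_ident_at) auto
  moreover have "\<forall>\<^sub>F m in at 0. product_sum_density n (m / sX) (m / sX) (sX * sY) r x = formula2 n m sX sY r x"
    using formula2_product_sum_density[OF sX sY r n x]
    by (auto simp: eventually_at_filter)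
  moreover have "mX / sX = 0" "mY / sY = 0" using True eq by simp_all
  ultimately show ?thesis
    using True by (simp only: value2_def tendsto_cong) simp
next
  case False
  then show ?thesis
    unfolding eq[symmetric] using formula2_product_sum_density[OF sX sY r n x] by (simp add: value2_def)
qed

text \<open>For vanishing means zero is approached along opposite normalized means. The limit is
  again the central density, so it agrees with the limit along equal ones when both cases
  apply.\<close>

lemma value3_product_sum_density:
  assumes sX: "sX > 0" and sY: "sY > 0" and r: "-1 < r" "r < 1" and n: "n \<ge> 1" and x: "x > 0"
    and eq: "mX / sX = - (mY / sY)"
  shows "value3 n mX sX sY r x (product_sum_density n (mX / sX) (mY / sY) (sX * sY) r x)"
proof (cases "mX = 0")
  case True
  have "((\<lambda>m. product_sum_density n (m / sX) (- (m / sX)) (sX * sY) r x) \<longlongrightarrow>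
      product_sum_density n 0 0 (sX * sY) r x) (at 0)"
    using assms by (intro tendsto_product_sum_density_0 tendsto_minus_cancel_left[THEN iffD1] tendsto_divide_zero tendsto_ident_at)
      (auto intro!: tendsto_eq_intros)
  moreover have "\<forall>\<^sub>F m in at 0. product_sum_density n (m / sX) (- (m / sX)) (sX * sY) r x = formula3 n m sX sY r x"
    using formula3_product_sum_density[OF sX sY r n x]
    by (auto simp: eventually_at_filter)
  moreover have "mX / sX = 0" "mY / sY = 0" using True eq by simp_all
  ultimately show ?thesis
    using True by (simp only: value3_def tendsto_cong) simp
next
  case False
  have "mY / sY = - (mX / sX)" using eq by simp
  with False show ?thesis
    using formula3_product_sum_density[OF sX sY r n x] by (simp add: value3_def)
qed

lemma borel_measurable_product_sum_density [measurable]: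
  assumes "n \<ge> 1"
  shows "product_sum_density n \<alpha> \<beta> c r \<in> borel_measurable borel"
proof -
  have "real n / 2 > 0" using assms by simp
  then show ?thesis
    unfolding product_sum_density_def[abs_def] gamma_difference_density_def by measurable
qed

lemma product_sum_density_nonneg:
  assumes "n \<ge> 1" "c > 0" "-1 < r" "r < 1"
  shows "0 \<le> product_sum_density n \<alpha> \<beta> c r x"
  unfolding product_sum_density_def using assms
  by (intro gamma_difference_density_nonneg) auto

theorem theorem2p8:
  fixes M :: "'a measure" and X Y :: "'a \<Rightarrow> real" and Z :: "nat \<Rightarrow> 'a \<Rightarrow> real"
    and mX mY sX sY r :: real and n :: nat
  assumes "prob_space M"
    and "sX > 0" and "sY > 0" and "-1 < r" and "r < 1"
    and "bivariate_normal M X Y mX mY sX sY r"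
    and "n \<ge> 1"
    and "prob_space.indep_vars M (\<lambda>_. borel) Z {1..n}"
    and "\<And>i. i \<in> {1..n} \<Longrightarrow> distr M borel (Z i) = distr M borel (\<lambda>\<omega>. X \<omega> * Y \<omega>)"
  shows "\<exists>f :: real \<Rightarrow> real.
    (\<forall>x. 0 \<le> f x) \<and>
    distributed M lborel (\<lambda>\<omega>. \<Sum>i=1..n. Z i \<omega>) (\<lambda>x. ennreal (f x)) \<and>
    (\<bar>mX\<bar> / sX \<noteq> \<bar>mY\<bar> / sY \<longrightarrow> (\<forall>x>0. value1 n mX mY sX sY r x (f x))) \<and>
    (mX / sX = mY / sY \<longrightarrow> (\<forall>x>0. value2 n mX sX sY r x (f x))) \<and>
    (mX / sX = - (mY / sY) \<longrightarrow> (\<forall>x>0. value3 n mX sX sY r x (f x))) \<and>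
    (\<bar>mX\<bar> / sX \<noteq> \<bar>- mY\<bar> / sY \<longrightarrow> (\<forall>x<0. value1 n mX (- mY) sX sY (- r) (- x) (f x))) \<and>
    (mX / sX = - mY / sY \<longrightarrow> (\<forall>x<0. value2 n mX sX sY (- r) (- x) (f x))) \<and>
    (mX / sX = - (- mY / sY) \<longrightarrow> (\<forall>x<0. value3 n mX sX sY (- r) (- x) (f x)))"
proof -
  interpret prob_space M by fact
  note sX = assms(2) and sY = assms(3) and r = assms(4,5) and n = assms(7)
  have r': "-1 < - r" "- r < 1" using r by auto
  define c where "c = sX * sY"
  have c: "c > 0" using sX sY by (simp add: c_def)
  define b b' where "b = 1 / (c * (1 + r))" and "b' = 1 / (c * (1 - r))"
  define d d' where "d = (mX / sX + mY / sY)\<^sup>2 / (4 * (1 + r))" and "d' = (mX / sX - mY / sY)\<^sup>2 / (4 * (1 - r))"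
  have b: "b > 0" "b' > 0" and d: "d \<ge> 0" "d' \<ge> 0"
    using c r by (auto simp: b_def b'_def d_def d'_def)
  have nd: "real n * d \<ge> 0" "real n * d' \<ge> 0" using d by auto
  define S where "S \<omega> = (\<Sum>i=1..n. Z i \<omega>)" for \<omega>
  \<comment> \<open>Negating \<open>r\<close> and the mean of \<open>Y\<close> exchanges the two
    rates and the two noncentralities, so the second branch is the density of the reversed
    difference at \<open>- x\<close>. The value at 0 is immaterial.\<close>
  define f where "f x = (if x > 0 then product_sum_density n (mX / sX) (mY / sY) c r x
    else product_sum_density n (mX / sX) (- mY / sY) c (- r) (- x))" for x
  \<comment> \<open>This is the density delivered by the convolution of measures. For
    \<open>n = 1\<close> it is infinite at 0, so it can equal the real-valued \<open>f\<close> only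
    away from that null point.\<close>
  define g where "g x = (\<integral>\<^sup>+y. ennreal (nc_gamma_density (real n / 2) b (real n * d) (x - y)) *
    ennreal (nc_gamma_density (real n / 2) b' (real n * d') (- y)) \<partial>lborel)" for x
  have f_nonneg: "0 \<le> f x" for x
    unfolding f_def using n c r r' by (auto intro!: product_sum_density_nonneg)
  have [measurable]: "f \<in> borel_measurable borel"
    unfolding f_def[abs_def] using n by measurable
  have [measurable]: "nc_gamma_density (real n / 2) b'' d'' \<in> borel_measurable borel" for b'' d''
    using n by (intro borel_measurable_nc_gamma_density) simp
  have [measurable]: "g \<in> borel_measurable borel"
    unfolding g_def[abs_def] by measurable
  have g: "g x = ennreal (f x)" if "x \<noteq> 0" for x
  proof (cases "x > 0")
    case True
    then show ?thesis
      using nn_integral_gamma_difference_pos[OF n b nd, of x]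
      by (simp add: g_def f_def product_sum_density_def b_def b'_def d_def d'_def)
  next
    case False
    then show ?thesis
      using nn_integral_gamma_difference_neg[OF n b nd, of x] that
      by (simp add: g_def f_def product_sum_density_def b_def b'_def d_def d'_def)
  qed
  have rv: "random_variable borel (Z i)" if "i \<in> {1..n}" for i
    using assms(8) that by (auto simp: indep_vars_def)
  have "distributed M lborel S (\<lambda>x. ennreal (f x))"
    unfolding distributed_def
  proof (intro conjI)
    show "S \<in> measurable M lborel"
      unfolding S_def[abs_def] using rv by simp
    have "distr M borel (Z i) = (nc_gamma_measure (1/2) b d \<star> reflected_nc_gamma_measure (1/2) b' d')" if "i \<in> {1..n}" for i
      using assms(9)[OF that] distr_bivariate_normal_product[OF assms(6) sX sY r]
      by (simp add: b_def b'_def d_def d'_def c_def)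
    then have "distr M borel S = (nc_gamma_measure (real (card {1..n}) / 2) b (real (card {1..n}) * d) \<star>
       reflected_nc_gamma_measure (real (card {1..n}) / 2) b' (real (card {1..n}) * d'))"
      unfolding S_def[abs_def] using n assms(8) b d by (intro distr_sum_nc_gamma_difference) auto
    also have "\<dots> = density lborel g"
      unfolding g_def using n b nd prob_space_nc_gamma_density[OF n b(1) nd(1)]
        prob_space_reflected_nc_gamma_measure[OF n b(2) nd(2)]
      by (simp add: convolution_density prob_space.finite_measure)
    also have "\<dots> = density lborel (\<lambda>x. ennreal (f x))"
    proof (rule density_cong)
      show "AE x in lborel. g x = ennreal (f x)"
        using AE_lborel_singleton[of "0::real"] by eventually_elim (rule g)
    qed auto
    finally show "distr M lborel S = density lborel (\<lambda>x. ennreal (f x))"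
      by (simp cong: distr_cong)
  qed simp
  then have distr_S: "distributed M lborel (\<lambda>\<omega>. \<Sum>i=1..n. Z i \<omega>) (\<lambda>x. ennreal (f x))"
    by (simp only: S_def[abs_def])
  have pos: "f x = product_sum_density n (mX / sX) (mY / sY) (sX * sY) r x" if "0 < x" for x
    using that by (simp add: f_def c_def)
  have neg: "f x = product_sum_density n (mX / sX) (- mY / sY) (sX * sY) (- r) (- x)" if "x < 0" for x
    using that by (simp add: f_def c_def)
  show ?thesis
  proof (intro exI[of _ f] conjI allI impI f_nonneg distr_S)
    fix x :: real assume x: "0 < x"
    show "value1 n mX mY sX sY r x (f x)" if "\<bar>mX\<bar> / sX \<noteq> \<bar>mY\<bar> / sY"
      unfolding pos[OF x] by (rule value1_product_sum_density) fact+
    show "value2 n mX sX sY r x (f x)" if "mX / sX = mY / sY"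
      unfolding pos[OF x] by (rule value2_product_sum_density) fact+
    show "value3 n mX sX sY r x (f x)" if "mX / sX = - (mY / sY)"
      unfolding pos[OF x] by (rule value3_product_sum_density) fact+
  next
    fix x :: real assume x: "x < 0"
    then have x': "0 < - x" by simp
    show "value1 n mX (- mY) sX sY (- r) (- x) (f x)" if "\<bar>mX\<bar> / sX \<noteq> \<bar>- mY\<bar> / sY"
      unfolding neg[OF x] by (rule value1_product_sum_density) fact+
    show "value2 n mX sX sY (- r) (- x) (f x)" if "mX / sX = - mY / sY"
      unfolding neg[OF x] by (rule value2_product_sum_density) fact+
    show "value3 n mX sX sY (- r) (- x) (f x)" if "mX / sX = - (- mY / sY)"
      unfolding neg[OF x] by (rule value3_product_sum_density) fact+
  qed
qed

end
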